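(* Let $R$ be a Krull domain. Suppose that for every finite subset $E\subset R$ there exist a subring $S\subseteq R$ and a retraction $\rho:R\to S$ such that $E\subseteq S$ and $S[[t]]$ is a unique factorization domain. Then $R[[t]]$ is a unique factorization domain.
   Context: For a subring $S\subseteq R$, a retraction $\rho:R\to S$ is a ring homomorphism with $\rho|_S=\mathrm{id}_S$. A (commutative integral) domain $R$ is a Krull domain if: (1) $\bigcap_{\mathfrak p} R_{\mathfrak p}=R$, the intersection being over all height-1 prime ideals $\mathfrak p$ of $R$; (2) each such $R_{\mathfrak p}$ is a (rank-1) discrete valuation ring; (3) each $0\neq a\in R$ is contained in only finitely many height-1 prime ideals. *)

theory Defs
  imports
    "HOL-Algebra.Algebraic_Closure_Type"
    "HOL-Computational_Algebra.Computational_Algebra"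
    "HOL-Library.Extended_Nat"
begin

text \<open>
  The ambient domain is the universe of a type of class \<^class>\<open>idom\<close>. Ring-theoretic predicates
  on it and on its subsets are those of the record-based algebra library, via the record
  \<^const>\<open>ring_of_type_algebra\<close> of the type-class operations. The power series ring and the
  fraction field of the ambient domain are then the types \<open>'a fps\<close> and \<open>'a fract\<close>.
\<close>

abbreviation whole_ring :: "'a::comm_ring_1 ring" where
  "whole_ring \<equiv> ring_of_type_algebra"

definition ring_on :: "'a::comm_ring_1 set \<Rightarrow> 'a ring" where
  "ring_on A = whole_ring\<lparr>carrier := A\<rparr>"

definition retraction_onto :: "'a::comm_ring_1 set \<Rightarrow> ('a \<Rightarrow> 'a) \<Rightarrow> bool" where
  "retraction_onto S \<rho> \<longleftrightarrow> \<rho> \<in> ring_hom whole_ring (ring_on S) \<and> (\<forall>s\<in>S. \<rho> s = s)"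

definition power_series_over :: "'a::comm_ring_1 set \<Rightarrow> 'a fps set" where
  "power_series_over S = {f. \<forall>n. fps_nth f n \<in> S}"

text \<open>
  The height of a prime \<open>P\<close>: the supremum of the lengths \<open>n\<close> of chains
  \<open>c 0 \<subset> \<dots> \<subset> c n = P\<close> of prime ideals.
\<close>

definition prime_height :: "'a::comm_ring_1 set \<Rightarrow> enat" where
  "prime_height P = Sup {enat n | n. \<exists>c :: nat \<Rightarrow> 'a set.
     (\<forall>i\<le>n. primeideal (c i) whole_ring) \<and> (\<forall>i<n. c i \<subset> c (Suc i)) \<and> c n = P}"

definition height_one_primes :: "'a::comm_ring_1 set set" where
  "height_one_primes = {P. primeideal P whole_ring \<and> prime_height P = 1}"

definition localization_at :: "'a::idom set \<Rightarrow> 'a fract set" where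
  "localization_at P = {Fract a s | a s. s \<notin> P}"

text \<open>
  A discrete valuation ring (of rank 1) is a principal ideal domain with exactly one nonzero
  prime ideal; in particular it is not a field.
\<close>

definition discrete_valuation_ring :: "('a, 'b) ring_scheme \<Rightarrow> bool" where
  "discrete_valuation_ring A \<longleftrightarrow>
     principal_domain A \<and> (\<exists>!M. primeideal M A \<and> M \<noteq> {\<zero>\<^bsub>A\<^esub>})"

text \<open>
  If there is no height-one prime (i.e. if the ring is a field), the intersection below is the
  whole fraction field, as it should be.
\<close>

definition krull_domain :: "'a::idom itself \<Rightarrow> bool" where
  "krull_domain _ \<longleftrightarrow>
     (\<Inter>P\<in>height_one_primes. localization_at P) = range (\<lambda>a::'a. Fract a 1) \<and>
     (\<forall>P\<in>(height_one_primes :: 'a set set).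
        discrete_valuation_ring (ring_on (localization_at P))) \<and>
     (\<forall>a::'a. a \<noteq> 0 \<longrightarrow> finite {P \<in> height_one_primes. a \<in> P})"

end

theory Submission
  imports Defs
begin

text \<open>
  Write \<open>R\<close> for the Krull domain and \<open>K\<close> for its fraction field. Factorizations in \<open>R[[X]]\<close> terminate,
  because the order in \<open>X\<close> plus the total valuation of the leading coefficient (a finite sum over the
  height-one primes) is an additive size that vanishes on units only (\<open>fps_size_mult_less\<close>). What has
  to be shown is that an irreducible series \<open>p\<close> is prime. The case \<open>p $ 0 = 0\<close> is that of \<open>X\<close>, so let
  \<open>p $ 0 \<noteq> 0\<close> and \<open>p dvd g * h\<close>.

  A retraction \<open>\<rho>\<close> onto a ring \<open>S\<close> that contains the first \<open>n\<close> coefficients of \<open>p\<close>, \<open>g\<close> and \<open>h\<close>, applied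
  coefficientwise, replaces these series by series over \<open>S\<close> that agree with them modulo \<open>X ^ n\<close>, and
  preserves the divisibility. If \<open>\<rho> p\<close> is irreducible in \<open>S[[X]]\<close>, it is prime there, so \<open>p\<close> divides \<open>g\<close>
  or \<open>h\<close> modulo \<open>X ^ n\<close>. One of the two holds for all \<open>n\<close>, and divisibility by \<open>p\<close> is a closed condition
  in the \<open>X\<close>-adic topology. So the proof reduces to a statement on Krull domains in which \<open>S\<close> no
  longer occurs: irreducibility of \<open>p\<close> is an open condition. Equivalently (\<open>reducibility_closed\<close>), if
  for every \<open>n\<close> there are non-units with \<open>p = a * b\<close> modulo \<open>X ^ n\<close>, then \<open>p\<close> is reducible.

  There is no compactness to produce a convergent sequence of factors, and the factors have to be
  compared at the height-one primes. Let \<open>V\<close> be one of the discrete valuation rings whose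
  intersection is \<open>R\<close>. The claim there (\<open>finitely_many_approximate_factors\<close>) is that a factor of
  a series close to \<open>p\<close> is close, up to a unit of \<open>V[[X]]\<close>, to one of finitely many series. This is
  clear if \<open>p $ 0\<close> is a unit of \<open>V\<close>. Otherwise there is a valuation ring \<open>W\<close> of \<open>K((X))\<close> that contains
  \<open>V[[X]]\<close> and \<open>p * V((X))\<close>, but not \<open>1 / X\<close>. The ideals
  \<open>I n = V[[X]] \<inter> X ^ n * W\<close> all contain \<open>p\<close>, and a product in \<open>I (2 * n)\<close> has a factor in \<open>I n\<close>, since
  \<open>W\<close> is a valuation ring. The constant terms of \<open>I n\<close> form a decreasing sequence of ideals of \<open>V\<close> that
  contain \<open>p $ 0\<close>, so they stabilize. As \<open>V[[X]]\<close> is \<open>X\<close>-adically complete, this gives a series \<open>g\<close>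
  in all \<open>I n\<close> such that \<open>I n\<close> is contained in the ideal of \<open>g\<close> and \<open>X ^ N\<close> for large \<open>n\<close>. Thus
  \<open>g\<close> divides \<open>p\<close>, and if \<open>a * b\<close> is close to \<open>p\<close>, then \<open>a\<close> or \<open>b\<close> is close to a multiple of \<open>g\<close>
  (\<open>ex_approximate_prime_factor\<close>). Cancelling \<open>g\<close>, an induction on the valuation of \<open>p $ 0\<close> finishes
  the local argument.

  Globally, \<open>p $ 0\<close> is a unit in all but finitely many \<open>V\<close>. By the pigeonhole principle there are
  approximate factors of \<open>p\<close>, for every precision \<open>N\<close>, that have the same local types at the remaining
  \<open>V\<close>. The quotient of two of them is a unit modulo \<open>X ^ N\<close> at every \<open>V\<close>, and so it is one over \<open>R\<close>.
  Correcting by these units makes the factors converge, and the limit divides \<open>p\<close>.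
\<close>

section \<open>Valuation subrings\<close>

locale unital_subring =
  fixes W :: "'a::comm_ring_1 set"
  assumes one_mem: "1 \<in> W"
    and diff_mem: "\<lbrakk>x \<in> W; y \<in> W\<rbrakk> \<Longrightarrow> x - y \<in> W"
    and mult_mem: "\<lbrakk>x \<in> W; y \<in> W\<rbrakk> \<Longrightarrow> x * y \<in> W"
begin

lemma zero_mem: "0 \<in> W"
  using diff_mem[OF one_mem one_mem] by simp

lemma uminus_mem: "x \<in> W \<Longrightarrow> - x \<in> W"
  using diff_mem[OF zero_mem, of x] by simp

lemma add_mem: "\<lbrakk>x \<in> W; y \<in> W\<rbrakk> \<Longrightarrow> x + y \<in> W"
  using diff_mem[of x "- y"] uminus_mem[of y] by simp

lemma sum_mem: "(\<And>i. i \<in> A \<Longrightarrow> f i \<in> W) \<Longrightarrow> sum f A \<in> W"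
  by (induction A rule: infinite_finite_induct) (auto simp: zero_mem add_mem)

lemma power_mem: "x \<in> W \<Longrightarrow> x ^ n \<in> W"
  by (induction n) (auto simp: one_mem mult_mem)

text \<open>
  The values at \<open>x\<close> of the polynomials of degree less than \<open>m\<close> over \<open>W\<close>. In terms of these sets, to
  lower the degree of a relation means to find a member of the next smaller set, and no polynomial
  has to be written down.
\<close>

definition low_degree_values :: "'a \<Rightarrow> nat \<Rightarrow> 'a set" where
  "low_degree_values x m = {\<Sum>i<m. a i * x ^ i | a. \<forall>i. a i \<in> W}"

lemma low_degree_values_add:
  assumes "y \<in> low_degree_values x m" "z \<in> low_degree_values x m"
  shows "y + z \<in> low_degree_values x m"
proof -
  obtain a b where "\<forall>i. a i \<in> W" "\<forall>i. b i \<in> W" "y = (\<Sum>i<m. a i * x ^ i)" "z = (\<Sum>i<m. b i * x ^ i)"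
    using assms unfolding low_degree_values_def by auto
  then show ?thesis
    unfolding low_degree_values_def
    by (auto intro!: exI[of _ "\<lambda>i. a i + b i"] simp: add_mem sum.distrib algebra_simps)
qed

lemma low_degree_values_scale:
  assumes "w \<in> W" "y \<in> low_degree_values x m"
  shows "w * y \<in> low_degree_values x m"
proof -
  obtain a where "\<forall>i. a i \<in> W" "y = (\<Sum>i<m. a i * x ^ i)"
    using assms unfolding low_degree_values_def by auto
  then show ?thesis
    unfolding low_degree_values_def using assms(1)
    by (auto intro!: exI[of _ "\<lambda>i. w * a i"] simp: mult_mem sum_distrib_left algebra_simps)
qed

lemma low_degree_values_power:
  assumes "w \<in> W" "i < m"
  shows "w * x ^ i \<in> low_degree_values x m"
proof -
  have "(\<Sum>j<m. (if j = i then w else 0) * x ^ j) = w * x ^ i"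
    using assms(2) by (simp add: if_distrib[of "\<lambda>c. c * _"] sum.delta cong: if_cong)
  then show ?thesis
    unfolding low_degree_values_def using assms(1)
    by (auto intro!: exI[of _ "\<lambda>j. if j = i then w else 0"] simp: zero_mem)
qed

lemma low_degree_values_sum:
  assumes "0 < m" "\<And>i. i \<in> A \<Longrightarrow> f i \<in> low_degree_values x m"
  shows "sum f A \<in> low_degree_values x m"
proof -
  have "0 \<in> low_degree_values x m"
    using low_degree_values_power[OF zero_mem assms(1)] by simp
  then show ?thesis
    using assms(2)
    by (induction A rule: infinite_finite_induct) (auto simp: low_degree_values_add)
qed

lemma low_degree_values_one: "low_degree_values x (Suc 0) \<subseteq> W"
  unfolding low_degree_values_def by auto

text \<open>
  The classical step in the proof that a maximal dominating subring is a valuation ring: of two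
  relations of degree \<open>m\<close> in \<open>x\<close> and \<open>l \<le> m\<close> in \<open>y\<close>, the second one is multiplied by \<open>x ^ m\<close> and
  eliminates the top coefficient of the first.
\<close>

lemma lower_degree_of_relation:
  assumes t: "t \<in> W" and xy: "x * y \<in> W" and "l \<le> m" "0 < m"
    and s: "s \<in> low_degree_values x (Suc m)" "t * s = 1"
    and r: "r \<in> low_degree_values y (Suc l)" "t * r = 1"
  shows "\<exists>s \<in> low_degree_values x m. t * s = 1"
proof -
  obtain a where a: "\<forall>i. a i \<in> W" "s = (\<Sum>i<Suc m. a i * x ^ i)"
    using s(1) unfolding low_degree_values_def by auto
  obtain b where b: "\<forall>i. b i \<in> W" "r = (\<Sum>i<Suc l. b i * y ^ i)"
    using r(1) unfolding low_degree_values_def by auto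
  define s' where "s' = (\<Sum>i<m. a i * x ^ i)"
  define z where "z = (\<Sum>j<l. b (Suc j) * (x * y) ^ Suc j * x ^ (m - Suc j))"
  have s'_mem: "s' \<in> low_degree_values x m"
    unfolding s'_def low_degree_values_def using a(1) by auto
  have z_mem: "z \<in> low_degree_values x m"
    unfolding z_def using b(1) assms(3,4)
    by (intro low_degree_values_sum low_degree_values_power mult_mem power_mem xy) auto
  have s_eq: "s = s' + a m * x ^ m"
    unfolding a(2) s'_def by simp
  have r_eq: "r = b 0 + (\<Sum>j<l. b (Suc j) * y ^ Suc j)"
    unfolding b(2) by (subst sum.lessThan_Suc_shift) simp
  have "x ^ m * (\<Sum>j<l. b (Suc j) * y ^ Suc j) = z"
    unfolding z_def sum_distrib_left
  proof (rule sum.cong[OF refl])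
    fix j assume "j \<in> {..<l}"
    then have "x ^ m = x ^ Suc j * x ^ (m - Suc j)"
      using assms(3) by (subst power_add[symmetric]) auto
    then show "x ^ m * (b (Suc j) * y ^ Suc j) = b (Suc j) * (x * y) ^ Suc j * x ^ (m - Suc j)"
      by (simp only: power_mult_distrib mult_ac)
  qed
  then have "x ^ m * (1 - t * b 0) = t * z"
    using r(2) unfolding r_eq by (metis (no_types, lifting) add_diff_cancel_left' distrib_left mult.left_commute)
  then have e: "a m * t * (x ^ m * (1 - t * b 0)) = a m * t * (t * z)"
    by simp
  have "1 = t * b 0 + (1 - t * b 0) * (t * s)"
    using s(2) by simp
  also have "\<dots> = t * (b 0 + (1 - t * b 0) * s') + a m * t * (x ^ m * (1 - t * b 0))"
    unfolding s_eq by (simp add: algebra_simps)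
  also have "\<dots> = t * (b 0 + (1 - t * b 0) * s' + a m * t * z)"
    unfolding e by (simp add: algebra_simps)
  finally have "t * (b 0 + (1 - t * b 0) * s' + a m * t * z) = 1"
    by simp
  moreover have "b 0 + (1 - t * b 0) * s' + a m * t * z \<in> low_degree_values x m"
    using low_degree_values_power[of "b 0" 0 m x] s'_mem z_mem assms(4) a(1) b(1) t
    by (intro low_degree_values_add low_degree_values_scale diff_mem one_mem mult_mem) auto
  ultimately show ?thesis by blast
qed

lemma adjoin_subring:
  shows "unital_subring (\<Union>m. low_degree_values x (Suc m))" (is "unital_subring ?U")
    and "W \<subseteq> (\<Union>m. low_degree_values x (Suc m))"
    and "x \<in> (\<Union>m. low_degree_values x (Suc m))"
proof -
  have mono: "low_degree_values x m \<subseteq> low_degree_values x n" if "m \<le> n" for m n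
  proof
    fix y assume "y \<in> low_degree_values x m"
    then obtain a where a: "\<forall>i. a i \<in> W" "y = (\<Sum>i<m. a i * x ^ i)"
      unfolding low_degree_values_def by auto
    have "y \<in> low_degree_values x n" if "0 < n"
      unfolding a(2) using a(1) \<open>m \<le> n\<close> that
      by (intro low_degree_values_sum low_degree_values_power) auto
    then show "y \<in> low_degree_values x n"
      using \<open>y \<in> _\<close> that by (cases "n = 0") auto
  qed
  have const: "w \<in> low_degree_values x (Suc 0)" if "w \<in> W" for w
    using low_degree_values_power[OF that, of 0 "Suc 0" x] by simp
  have mult: "y * z \<in> ?U" if yz: "y \<in> low_degree_values x m" "z \<in> low_degree_values x n" for y z m n
  proof -
    obtain a where a: "\<forall>i. a i \<in> W" "y = (\<Sum>i<m. a i * x ^ i)"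
      using yz(1) unfolding low_degree_values_def by auto
    obtain b where b: "\<forall>i. b i \<in> W" "z = (\<Sum>i<n. b i * x ^ i)"
      using yz(2) unfolding low_degree_values_def by auto
    have "y * z = (\<Sum>i<m. \<Sum>j<n. (a i * b j) * x ^ (i + j))"
      unfolding a(2) b(2) sum_product by (simp add: power_add algebra_simps)
    also have "\<dots> \<in> low_degree_values x (Suc (m + n))"
      using a(1) b(1) by (intro low_degree_values_sum low_degree_values_power mult_mem) auto
    finally show ?thesis by blast
  qed
  show "unital_subring ?U"
  proof
    show "1 \<in> ?U"
      using const[OF one_mem] by blast
    fix y z assume "y \<in> ?U" "z \<in> ?U"
    then obtain m n where mn: "y \<in> low_degree_values x (Suc m)" "z \<in> low_degree_values x (Suc n)"
      by auto
    then show "y * z \<in> ?U"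
      using mult by blast
    have "y \<in> low_degree_values x (Suc (max m n))" "z \<in> low_degree_values x (Suc (max m n))"
      using mn mono[of "Suc m" "Suc (max m n)"] mono[of "Suc n" "Suc (max m n)"] by auto
    then have "y + (- 1) * z \<in> low_degree_values x (Suc (max m n))"
      by (intro low_degree_values_add low_degree_values_scale uminus_mem one_mem)
    then show "y - z \<in> ?U"
      by auto
  qed
  show "W \<subseteq> ?U"
    using const by blast
  show "x \<in> ?U"
    using low_degree_values_power[OF one_mem, of 1 "Suc 1" x] by auto
qed

end

text \<open>
  Take for \<open>W\<close> a maximal subring that does not contain \<open>u\<close>, by Zorn's lemma. If neither \<open>x\<close> nor \<open>y\<close> lies in
  \<open>W\<close>, then by maximality \<open>u = 1 / t\<close> lies in \<open>W[x]\<close> and in \<open>W[y]\<close>, and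
  by \<open>lower_degree_of_relation\<close> relations of minimal degree contradict each other if \<open>x * y \<in> W\<close>.
\<close>

lemma ex_valuation_subring:
  assumes W0: "unital_subring W\<^sub>0" and t: "t \<in> W\<^sub>0" "t * u = 1" and u: "u \<notin> W\<^sub>0"
  shows "\<exists>W. unital_subring W \<and> W\<^sub>0 \<subseteq> W \<and> u \<notin> W \<and> (\<forall>x y. x * y \<in> W \<longrightarrow> x \<in> W \<or> y \<in> W)"
proof -
  define \<A> where "\<A> = {W. unital_subring W \<and> W\<^sub>0 \<subseteq> W \<and> u \<notin> W}"
  have "\<exists>W\<in>\<A>. \<forall>W'\<in>\<A>. W \<subseteq> W' \<longrightarrow> W' = W"
  proof (rule subset_Zorn_nonempty)
    show "\<A> \<noteq> {}"
      using W0 u unfolding \<A>_def by blast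
    fix C assume C: "C \<noteq> {}" "subset.chain \<A> C"
    have sub: "C \<subseteq> \<A>" and chain: "\<And>U V. U \<in> C \<Longrightarrow> V \<in> C \<Longrightarrow> U \<subseteq> V \<or> V \<subseteq> U"
      using C(2) by (auto simp: subset_chain_def)
    have "unital_subring (\<Union>C)"
    proof
      show "1 \<in> \<Union>C"
        using C(1) sub unital_subring.one_mem unfolding \<A>_def by blast
      fix x y assume "x \<in> \<Union>C" "y \<in> \<Union>C"
      then obtain U where "U \<in> C" "x \<in> U" "y \<in> U"
        using chain by blast
      then show "x - y \<in> \<Union>C" "x * y \<in> \<Union>C"
        using sub unital_subring.diff_mem unital_subring.mult_mem unfolding \<A>_def by blast+
    qed
    then show "\<Union>C \<in> \<A>"
      using C(1) sub unfolding \<A>_def by blast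
  qed
  then obtain W where W: "W \<in> \<A>" and max: "\<And>W'. W' \<in> \<A> \<Longrightarrow> W \<subseteq> W' \<Longrightarrow> W' = W"
    by blast
  interpret unital_subring W
    using W unfolding \<A>_def by blast
  have tW: "t \<in> W" and uW: "u \<notin> W"
    using W t unfolding \<A>_def by auto
  have relation: "\<exists>m. \<exists>s\<in>low_degree_values x (Suc m). t * s = 1" if "x \<notin> W" for x
  proof -
    have "(\<Union>m. low_degree_values x (Suc m)) \<notin> \<A>"
      using max adjoin_subring(2,3)[of x] that by blast
    then have "u \<in> (\<Union>m. low_degree_values x (Suc m))"
      using W adjoin_subring[of x] unfolding \<A>_def by blast
    then show ?thesis
      using t(2) by auto
  qed
  have no_const: "\<not> (\<exists>s\<in>low_degree_values x (Suc 0). t * s = 1)" for x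
  proof
    assume "\<exists>s\<in>low_degree_values x (Suc 0). t * s = 1"
    then obtain s where s: "s \<in> W" "t * s = 1"
      using low_degree_values_one by blast
    have "u = u * (t * s)" using s by simp
    also have "\<dots> = (t * u) * s" by (simp only: mult_ac)
    also have "\<dots> = s" using t by simp
    finally show False
      using uW s(1) by simp
  qed
  have "x \<in> W \<or> y \<in> W" if xy: "x * y \<in> W" for x y
  proof (rule ccontr)
    assume "\<not> (x \<in> W \<or> y \<in> W)"
    then have nx: "x \<notin> W" and ny: "y \<notin> W" by auto
    define m where "m = (LEAST m. \<exists>s\<in>low_degree_values x (Suc m). t * s = 1)"
    define l where "l = (LEAST l. \<exists>s\<in>low_degree_values y (Suc l). t * s = 1)"
    have m: "\<exists>s\<in>low_degree_values x (Suc m). t * s = 1"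
      unfolding m_def using relation[OF nx] by (rule LeastI_ex)
    have l: "\<exists>s\<in>low_degree_values y (Suc l). t * s = 1"
      unfolding l_def using relation[OF ny] by (rule LeastI_ex)
    have m_pos: "0 < m" and l_pos: "0 < l"
      using m l no_const by (metis gr0I)+
    have m_least: "\<not> (\<exists>s\<in>low_degree_values x m. t * s = 1)"
      using m_pos not_less_Least[of "m - 1" "\<lambda>m. \<exists>s\<in>low_degree_values x (Suc m). t * s = 1"]
      unfolding m_def[symmetric] by simp
    have l_least: "\<not> (\<exists>s\<in>low_degree_values y l. t * s = 1)"
      using l_pos not_less_Least[of "l - 1" "\<lambda>l. \<exists>s\<in>low_degree_values y (Suc l). t * s = 1"]
      unfolding l_def[symmetric] by simp
    show False
    proof (cases "l \<le> m")
      case True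
      then show False
        using lower_degree_of_relation[OF tW xy True m_pos] m l m_least by blast
    next
      case False
      then show False
        using lower_degree_of_relation[OF tW, of y x m l] xy l_pos m l l_least
        by (auto simp: mult.commute)
    qed
  qed
  then show ?thesis
    using W unfolding \<A>_def by blast
qed

section \<open>Congruences between power series\<close>

lemma X_pow_dvd_iff: "fps_X ^ n dvd (x :: 'a::comm_ring_1 fps) \<longleftrightarrow> (\<forall>i<n. x $ i = 0)"
proof
  assume "fps_X ^ n dvd x"
  then obtain z where "x = fps_X ^ n * z" ..
  then show "\<forall>i<n. x $ i = 0"
    by (simp add: fps_X_power_mult_nth)
next
  assume "\<forall>i<n. x $ i = 0"
  then have "x = fps_X ^ n * fps_shift n x"
    by (auto simp: fps_eq_iff fps_X_power_mult_nth)
  then show "fps_X ^ n dvd x" ..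
qed

lemma X_pow_dvd_trans:
  "fps_X ^ n dvd x - y \<Longrightarrow> fps_X ^ n dvd y - z \<Longrightarrow> fps_X ^ n dvd x - (z :: 'a::comm_ring_1 fps)"
  using dvd_add[of "fps_X ^ n" "x - y" "y - z"] by simp

lemma X_pow_dvd_sym: "fps_X ^ n dvd x - y \<Longrightarrow> fps_X ^ n dvd y - (x :: 'a::comm_ring_1 fps)"
  using dvd_minus_iff[of "fps_X ^ n" "x - y"] by simp

lemma X_pow_dvd_mono: "fps_X ^ n dvd (x :: 'a::comm_ring_1 fps) \<Longrightarrow> m \<le> n \<Longrightarrow> fps_X ^ m dvd x"
  using power_le_dvd by blast

lemma X_pow_dvd_cancel:
  fixes u :: "'k::field fps"
  assumes "u $ 0 \<noteq> 0" "fps_X ^ n dvd u * x"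
  shows "fps_X ^ n dvd x"
proof -
  have "x = inverse u * (u * x)"
    using inverse_mult_eq_1[OF assms(1)] by (simp add: mult.assoc[symmetric])
  then show ?thesis
    using assms(2) by (metis dvd_mult)
qed

text \<open>
  The formula for the coefficients is kept in the conclusion since it shows that the limit has
  coefficients in any set that contains those of the \<open>G n\<close>.
\<close>

lemma X_adic_limit:
  fixes G :: "nat \<Rightarrow> 'a::comm_ring_1 fps"
  assumes "\<And>n. fps_X ^ n dvd G (Suc n) - G n"
  obtains P where "\<And>n. fps_X ^ n dvd P - G n" "\<And>i. P $ i = G (Suc i) $ i"
proof -
  define P where "P = Abs_fps (\<lambda>i. G (Suc i) $ i)"
  have nth: "P $ i = G m $ i" if "i < m" for i m
    using that
  proof (induction m)
    case (Suc m)
    show ?case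
    proof (cases "i = m")
      case False
      then have "i < m" using Suc.prems by simp
      then have "G (Suc m) $ i = G m $ i"
        using assms[of m] unfolding X_pow_dvd_iff by simp
      then show ?thesis
        using Suc.IH \<open>i < m\<close> by simp
    qed (simp add: P_def)
  qed simp
  then have "fps_X ^ n dvd P - G n" for n
    unfolding X_pow_dvd_iff by simp
  then show thesis
    by (rule that) (simp add: P_def)
qed

context unital_subring
begin

lemma power_series_subring: "unital_subring (power_series_over W)"
proof
  show "1 \<in> power_series_over W"
    by (simp add: power_series_over_def one_mem zero_mem)
qed (auto simp: power_series_over_def fps_mult_nth diff_mem intro!: sum_mem mult_mem)

lemmas PS_one = unital_subring.one_mem[OF power_series_subring]
  and PS_zero = unital_subring.zero_mem[OF power_series_subring]
  and PS_diff = unital_subring.diff_mem[OF power_series_subring]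
  and PS_add = unital_subring.add_mem[OF power_series_subring]
  and PS_mult = unital_subring.mult_mem[OF power_series_subring]
  and PS_power = unital_subring.power_mem[OF power_series_subring]

lemma const_mem_PS: "c \<in> W \<Longrightarrow> fps_const c \<in> power_series_over W"
  by (simp add: power_series_over_def zero_mem)

lemma X_mem_PS: "fps_X \<in> power_series_over W"
  by (simp add: power_series_over_def fps_X_def zero_mem one_mem)

lemma nth_mem_PS: "x \<in> power_series_over W \<Longrightarrow> x $ i \<in> W"
  by (simp add: power_series_over_def)

lemma X_pow_dvd_PS:
  assumes "x \<in> power_series_over W" "fps_X ^ n dvd x"
  obtains z where "z \<in> power_series_over W" "x = fps_X ^ n * z"
proof
  show "fps_shift n x \<in> power_series_over W"
    using assms(1) by (simp add: power_series_over_def)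
  show "x = fps_X ^ n * fps_shift n x"
    using assms(2) unfolding X_pow_dvd_iff by (auto simp: fps_eq_iff fps_X_power_mult_nth)
qed

end

locale subring_of_field = unital_subring W for W :: "'k::field set"
begin

definition units :: "'k set" where
  "units = {u \<in> W. u \<noteq> 0 \<and> inverse u \<in> W}"

lemma units_mult: "u \<in> units \<Longrightarrow> v \<in> units \<Longrightarrow> u * v \<in> units"
  unfolding units_def by (auto simp: mult_mem)

lemma units_one: "1 \<in> units"
  unfolding units_def by (auto simp: one_mem)

lemma units_factor:
  assumes "x \<in> W" "y \<in> W" "x * y \<in> units"
  shows "x \<in> units"
proof -
  have nz: "x \<noteq> 0" "y \<noteq> 0" and inv: "inverse (x * y) \<in> W"
    using assms unfolding units_def by auto
  have "y * inverse (x * y) = inverse x"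
    using nz by (simp add: field_simps)
  then have "inverse x \<in> W"
    using mult_mem[OF assms(2) inv] by (simp only:)
  then show ?thesis
    using assms(1) nz unfolding units_def by simp
qed

lemma inverse_mem_PS:
  assumes "x \<in> power_series_over W" "x $ 0 \<in> units"
  shows "inverse x \<in> power_series_over W"
proof -
  have "inverse x $ n \<in> W" for n
  proof (induction n rule: less_induct)
    case (less n)
    have c: "inverse (x $ 0) \<in> W" "x $ 0 \<noteq> 0"
      using assms(2) unfolding units_def by auto
    show ?case
    proof (cases "n = 0")
      case True
      then show ?thesis using c by simp
    next
      case False
      have "inverse x $ n = - inverse (x $ 0) * (\<Sum>i=1..n. x $ i * inverse x $ (n - i))"
        using False c(2) by (cases n) (simp_all add: fps_inverse_def)
      also have "\<dots> \<in> W"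
        using assms(1) c less.IH by (intro mult_mem uminus_mem sum_mem) (auto intro: nth_mem_PS)
      finally show ?thesis .
    qed
  qed
  then show ?thesis
    by (simp add: power_series_over_def)
qed

text \<open>
  Divisibility by a series with nonzero constant term is a closed condition in the \<open>X\<close>-adic
  topology, since the quotient exists over the field and is determined coefficient by coefficient.
\<close>

lemma dvd_closed:
  assumes "p $ 0 \<noteq> 0" "\<And>n. \<exists>r\<in>power_series_over W. fps_X ^ n dvd f - p * r"
  shows "f * inverse p \<in> power_series_over W" "f = p * (f * inverse p)"
proof -
  have inv: "p * inverse p = 1"
    using inverse_mult_eq_1'[OF assms(1)] .
  then show f: "f = p * (f * inverse p)"
    by (metis mult.left_commute mult.right_neutral)
  have "(f * inverse p) $ i \<in> W" for i
  proof -
    obtain r where r: "r \<in> power_series_over W" "fps_X ^ Suc i dvd f - p * r"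
      using assms(2) by blast
    have "fps_X ^ Suc i dvd p * (f * inverse p - r)"
      using r(2) f by (metis right_diff_distrib)
    then have "fps_X ^ Suc i dvd f * inverse p - r"
      by (rule X_pow_dvd_cancel[OF assms(1)])
    then have "(f * inverse p) $ i = r $ i"
      unfolding X_pow_dvd_iff by simp
    then show ?thesis
      using nth_mem_PS[OF r(1)] by simp
  qed
  then show "f * inverse p \<in> power_series_over W"
    by (simp add: power_series_over_def)
qed

end

section \<open>Discrete valuation subrings of a field\<close>

text \<open>
  Discrete valuation rings inside a given field, in the form in which they are used: every nonzero
  element is a unit times a power of one fixed non-unit.
\<close>

locale discrete_valuation_subring = subring_of_field +
  assumes ex_uniformizer: "\<exists>\<pi>\<in>W. \<pi> \<noteq> 0 \<and> inverse \<pi> \<notin> W \<and>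
    (\<forall>x\<in>W. x \<noteq> 0 \<longrightarrow> (\<exists>k. \<exists>u\<in>units. x = u * \<pi> ^ k))"
begin

definition uniformizer :: 'a where
  "uniformizer = (SOME \<pi>. \<pi> \<in> W \<and> \<pi> \<noteq> 0 \<and> inverse \<pi> \<notin> W \<and>
    (\<forall>x\<in>W. x \<noteq> 0 \<longrightarrow> (\<exists>k. \<exists>u\<in>units. x = u * \<pi> ^ k)))"

lemma uniformizer:
  "uniformizer \<in> W" "uniformizer \<noteq> 0" "inverse uniformizer \<notin> W"
  "\<lbrakk>x \<in> W; x \<noteq> 0\<rbrakk> \<Longrightarrow> \<exists>k. \<exists>u\<in>units. x = u * uniformizer ^ k"
proof -
  have "\<exists>\<pi>. \<pi> \<in> W \<and> \<pi> \<noteq> 0 \<and> inverse \<pi> \<notin> W \<and>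
      (\<forall>x\<in>W. x \<noteq> 0 \<longrightarrow> (\<exists>k. \<exists>u\<in>units. x = u * \<pi> ^ k))"
    using ex_uniformizer by blast
  from someI_ex[OF this, folded uniformizer_def]
  show "uniformizer \<in> W" "uniformizer \<noteq> 0" "inverse uniformizer \<notin> W"
    "\<lbrakk>x \<in> W; x \<noteq> 0\<rbrakk> \<Longrightarrow> \<exists>k. \<exists>u\<in>units. x = u * uniformizer ^ k"
    by blast+
qed

lemma unit_times_power_unique:
  assumes "u \<in> units" "v \<in> units" "u * uniformizer ^ k = v * uniformizer ^ l"
  shows "k = l"
proof -
  have *: False if "u \<in> units" "v \<in> units" "u * uniformizer ^ k = v * uniformizer ^ l" "k < l" for u v k l
  proof -
    obtain d where l: "l = k + Suc d"
      using \<open>k < l\<close> less_iff_Suc_add by auto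
    have "u = v * uniformizer ^ Suc d"
      using that(3) uniformizer(2) unfolding l power_add by simp
    then have "uniformizer * (uniformizer ^ d * v) \<in> units"
      using that(1) by (simp add: mult_ac)
    moreover have "uniformizer ^ d * v \<in> W"
      using that(2) uniformizer(1) unfolding units_def by (auto intro: mult_mem power_mem)
    ultimately have "uniformizer \<in> units"
      using units_factor uniformizer(1) by blast
    then show False
      using uniformizer(3) unfolding units_def by simp
  qed
  show ?thesis
    using *[OF assms] *[OF assms(2,1) assms(3)[symmetric]] by (metis linorder_neqE_nat)
qed

definition ord :: "'a \<Rightarrow> nat" where
  "ord x = (THE k. \<exists>u\<in>units. x = u * uniformizer ^ k)"

lemma ord_eq: "u \<in> units \<Longrightarrow> ord (u * uniformizer ^ k) = k"
  unfolding ord_def by (rule the_equality) (auto dest: unit_times_power_unique)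

lemma ord_decomp:
  assumes "x \<in> W" "x \<noteq> 0"
  obtains u k where "u \<in> units" "x = u * uniformizer ^ k" "ord x = k"
  using uniformizer(4)[OF assms] ord_eq that by blast

lemma ord_mult:
  assumes "x \<in> W" "x \<noteq> 0" "y \<in> W" "y \<noteq> 0"
  shows "ord (x * y) = ord x + ord y"
proof -
  obtain u k where u: "u \<in> units" "x = u * uniformizer ^ k" "ord x = k"
    using ord_decomp assms(1,2) by blast
  obtain v l where v: "v \<in> units" "y = v * uniformizer ^ l" "ord y = l"
    using ord_decomp assms(3,4) by blast
  have "x * y = (u * v) * uniformizer ^ (k + l)"
    unfolding u(2) v(2) by (simp add: power_add mult_ac)
  then show ?thesis
    using ord_eq[OF units_mult[OF u(1) v(1)]] u(3) v(3) by simp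
qed

lemma ord_eq_0_iff:
  assumes "x \<in> W" "x \<noteq> 0"
  shows "ord x = 0 \<longleftrightarrow> x \<in> units"
proof
  assume "ord x = 0"
  then show "x \<in> units"
    using ord_decomp[OF assms] by (metis mult.right_neutral power_0)
next
  assume "x \<in> units"
  then show "ord x = 0"
    using ord_eq[of x 0] by simp
qed

lemma dvd_of_ord_le:
  assumes "x \<in> W" "y \<in> W" "x \<noteq> 0" "y \<noteq> 0" "ord x \<le> ord y"
  shows "\<exists>r\<in>W. y = x * r"
proof -
  obtain u k where u: "u \<in> units" "x = u * uniformizer ^ k" "ord x = k"
    using ord_decomp assms(1,3) by blast
  obtain v l where v: "v \<in> units" "y = v * uniformizer ^ l" "ord y = l"
    using ord_decomp assms(2,4) by blast
  define r where "r = inverse u * v * uniformizer ^ (l - k)"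
  have "uniformizer ^ l = uniformizer ^ k * uniformizer ^ (l - k)"
    using assms(5) u(3) v(3) by (simp flip: power_add)
  moreover have "u \<noteq> 0" using u(1) unfolding units_def by simp
  ultimately have "y = x * r"
    unfolding r_def u(2) v(2) by simp
  moreover have "r \<in> W"
    unfolding r_def using u(1) v(1) uniformizer(1) unfolding units_def
    by (auto intro: mult_mem power_mem)
  ultimately show ?thesis by blast
qed

end

section \<open>A valuative filtration of a power series ring\<close>

text \<open>
  The properties of \<open>I n = W[[X]] \<inter> X ^ n * U\<close>, where \<open>U\<close> is a valuation ring of the field of Laurent
  series that contains \<open>W[[X]]\<close> and all \<open>f / X ^ n\<close>, but not \<open>1 / X\<close>. Stating them as axioms keeps the
  Laurent series out of what follows.
\<close>

locale valuative_filtration = discrete_valuation_subring +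
  fixes f :: "'a fps" and I :: "nat \<Rightarrow> 'a fps set"
  assumes I_sub: "x \<in> I n \<Longrightarrow> x \<in> power_series_over W"
    and I_diff: "\<lbrakk>x \<in> I n; y \<in> I n\<rbrakk> \<Longrightarrow> x - y \<in> I n"
    and I_mult: "\<lbrakk>x \<in> I n; y \<in> power_series_over W\<rbrakk> \<Longrightarrow> x * y \<in> I n"
    and I_decreasing: "x \<in> I (Suc n) \<Longrightarrow> x \<in> I n"
    and f_I: "f \<in> I n"
    and X_pow_I: "z \<in> power_series_over W \<Longrightarrow> fps_X ^ n * z \<in> I n"
    and X_cancel_I: "\<lbrakk>y \<in> power_series_over W; fps_X * y \<in> I (Suc n)\<rbrakk> \<Longrightarrow> y \<in> I n"
    and one_notin_I: "1 \<notin> I 1"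
    and prime_I: "\<lbrakk>x \<in> power_series_over W; y \<in> power_series_over W; x * y \<in> I (2 * n)\<rbrakk>
      \<Longrightarrow> x \<in> I n \<or> y \<in> I n"

text \<open>
  The valuation ring is obtained from \<open>ex_valuation_subring\<close>, applied to the subring \<open>W[[X]] + f * W((X))\<close>.
  That \<open>1 / X\<close> does not belong to it is where \<open>f $ 0\<close> has to be a non-unit.
\<close>

lemma (in discrete_valuation_subring) ex_valuative_filtration:
  assumes f: "f \<in> power_series_over W" "f $ 0 \<noteq> 0" "f $ 0 \<notin> units"
  shows "\<exists>I. valuative_filtration W f I"
proof -
  let ?P = "power_series_over W"
  let ?e = "fps_to_fls :: 'a fps \<Rightarrow> 'a fls"
  define T where "T = (fls_X_inv :: 'a fls)"
  have XT: "?e fps_X * T = 1"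
    unfolding T_def by (simp add: fls_X_times_conv_shift)
  have XTn: "?e (fps_X ^ n) * T ^ n = 1" for n
    using XT by (simp add: fps_to_fls_power flip: power_mult_distrib)
  have e_mult: "?e (x * y) = ?e x * ?e y" for x y
    by (rule fls_times_fps_to_fls)
  have Tadd: "T ^ n * y = T ^ (n + m) * (?e (fps_X ^ m) * y)" for n m y
  proof -
    have "T ^ (n + m) * (?e (fps_X ^ m) * y) = T ^ n * y * (?e (fps_X ^ m) * T ^ m)"
      by (simp only: power_add mult_ac)
    then show ?thesis by (simp only: XTn mult_1_right)
  qed
  define W0 where "W0 = {?e y + T ^ n * ?e (f * x) | n x y. x \<in> ?P \<and> y \<in> ?P}"
  have W0I: "?e y + T ^ n * ?e (f * x) \<in> W0" if "x \<in> ?P" "y \<in> ?P" for n x y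
    unfolding W0_def using that by blast
  have W0: "unital_subring W0"
  proof
    show "1 \<in> W0"
      using W0I[OF PS_zero PS_one, of 0] by simp
    fix a b assume "a \<in> W0" "b \<in> W0"
    then obtain n x y m x' y' where
      a: "a = ?e y + T ^ n * ?e (f * x)" "x \<in> ?P" "y \<in> ?P" and
      b: "b = ?e y' + T ^ m * ?e (f * x')" "x' \<in> ?P" "y' \<in> ?P"
      unfolding W0_def by blast
    have a': "a = ?e y + T ^ (n + m) * ?e (f * (fps_X ^ m * x))"
      unfolding a(1) by (subst Tadd[of n _ m]) (simp only: e_mult mult_ac)
    have b': "b = ?e y' + T ^ (n + m) * ?e (f * (fps_X ^ n * x'))"
      unfolding b(1) by (subst Tadd[of m _ n]) (simp only: e_mult mult_ac add.commute)
    have "a - b = ?e (y - y') + T ^ (n + m) * ?e (f * (fps_X ^ m * x - fps_X ^ n * x'))"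
      unfolding a' b' by (simp add: algebra_simps)
    also have "\<dots> \<in> W0"
      using a(2,3) b(2,3) by (intro W0I PS_diff PS_mult PS_power X_mem_PS)
    finally show "a - b \<in> W0" .
    have "a * b = ?e y * ?e y' + ?e y * (T ^ (n + m) * ?e (f * (fps_X ^ n * x')))
       + ?e y' * (T ^ (n + m) * ?e (f * (fps_X ^ m * x))) + T ^ (n + m) * (?e (f * x) * ?e (f * x'))"
    proof -
      have "a * b = ?e y * b + ?e y' * (T ^ n * ?e (f * x)) + T ^ (n + m) * (?e (f * x) * ?e (f * x'))"
        unfolding a(1) b(1) by (simp add: algebra_simps power_add)
      also have "T ^ n * ?e (f * x) = T ^ (n + m) * ?e (f * (fps_X ^ m * x))"
        by (subst Tadd[of n _ m]) (simp only: e_mult mult_ac)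
      finally show ?thesis
        unfolding b' by (simp add: algebra_simps)
    qed
    also have "\<dots> = ?e (y * y') + T ^ (n + m) *
        ?e (f * (y * (fps_X ^ n * x') + y' * (fps_X ^ m * x) + f * x * x'))"
      by (simp add: e_mult algebra_simps)
    also have "\<dots> \<in> W0"
      using a(2,3) b(2,3) f(1) by (intro W0I PS_add PS_mult PS_power X_mem_PS)
    finally show "a * b \<in> W0" .
  qed
  have P_W0: "?e y \<in> W0" if "y \<in> ?P" for y
    using W0I[OF PS_zero that, of 0] by simp
  \<comment> \<open>If \<open>1 / X\<close> were in the subring, \<open>f\<close> would divide \<open>X ^ n * (1 - X * y)\<close>, and comparing the
      lowest coefficients would make \<open>f $ 0\<close> a unit.\<close>
  have "T \<notin> W0"
  proof
    assume "T \<in> W0"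
    then obtain n x y where T: "T = ?e y + T ^ n * ?e (f * x)" and xy: "x \<in> ?P" "y \<in> ?P"
      unfolding W0_def by blast
    have "?e (fps_X ^ Suc n) * T = ?e (fps_X ^ Suc n) * ?e y + (?e (fps_X ^ n) * T ^ n) * ?e (fps_X * (f * x))"
      by (subst T) (simp only: e_mult power_Suc distrib_left mult_ac)
    moreover have "?e (fps_X ^ Suc n) * T = ?e (fps_X ^ n)"
      using XT by (simp only: e_mult power_Suc2 mult_ac) simp
    ultimately have "?e (fps_X ^ n) = ?e (fps_X ^ Suc n * y + fps_X * (f * x))"
      unfolding XTn by (simp add: e_mult)
    then have eq: "fps_X ^ n = fps_X ^ Suc n * y + fps_X * (f * x)"
      by (rule fps_to_fls_eq_imp_fps_eq)
    show False
    proof (cases n)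
      case 0
      then show False
        using arg_cong[OF eq, of "\<lambda>z. z $ 0"] by simp
    next
      case (Suc m)
      have "fps_X * (fps_X ^ Suc m * y + f * x) = fps_X ^ Suc (Suc m) * y + fps_X * (f * x)"
        by (simp add: algebra_simps)
      also have "\<dots> = fps_X ^ Suc m"
        by (rule eq[unfolded Suc, symmetric])
      also have "\<dots> = fps_X * fps_X ^ m"
        by (rule power_Suc)
      finally have "fps_X ^ m = fps_X ^ Suc m * y + f * x"
        by (simp only: mult_left_cancel[OF fps_X_neq_zero])
      then have "f * x = fps_X ^ m - fps_X ^ Suc m * y"
        by (metis add_diff_cancel_left')
      then have fx: "f * x = fps_X ^ m * (1 - fps_X * y)"
        by (simp add: algebra_simps)
      have inv: "inverse f * f = 1"
        using inverse_mult_eq_1[OF f(2)] .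
      have "x = inverse f * (f * x)"
        using inv by (simp add: mult.assoc[symmetric])
      also have "\<dots> = fps_X ^ m * (inverse f * (1 - fps_X * y))"
        unfolding fx by (simp only: mult_ac)
      finally have "x $ m = (fps_X ^ m * (inverse f * (1 - fps_X * y))) $ m"
        by (rule arg_cong)
      also have "\<dots> = inverse (f $ 0)"
        by (simp add: fps_X_power_mult_nth)
      finally show False
        using nth_mem_PS[OF xy(1), of m] nth_mem_PS[OF f(1), of 0] f unfolding units_def by simp
    qed
  qed
  then obtain U where U: "unital_subring U" "W0 \<subseteq> U" "T \<notin> U"
    and U_prime: "\<And>x y. x * y \<in> U \<Longrightarrow> x \<in> U \<or> y \<in> U"
    using ex_valuation_subring[OF W0 P_W0[OF X_mem_PS] XT] by auto
  interpret U: unital_subring U by fact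
  have P_U: "?e y \<in> U" if "y \<in> ?P" for y
    using P_W0[OF that] U(2) by blast
  define I where "I n = {x \<in> ?P. T ^ n * ?e x \<in> U}" for n
  have "valuative_filtration W f I"
  proof
    fix n :: nat
    show "x \<in> ?P" if "x \<in> I n" for x
      using that unfolding I_def by simp
    show "x - y \<in> I n" if "x \<in> I n" "y \<in> I n" for x y
      using that unfolding I_def by (auto simp: PS_diff right_diff_distrib U.diff_mem)
    show "x * y \<in> I n" if "x \<in> I n" "y \<in> ?P" for x y
    proof -
      have "T ^ n * ?e (x * y) = (T ^ n * ?e x) * ?e y"
        by (simp only: e_mult mult_ac)
      also have "\<dots> \<in> U"
        using that P_U unfolding I_def by (auto intro: U.mult_mem)
      finally show ?thesis
        using that unfolding I_def by (simp add: PS_mult)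
    qed
    show "x \<in> I n" if "x \<in> I (Suc n)" for x
    proof -
      have "T ^ n * ?e x = T ^ Suc n * ?e x * ?e fps_X"
        using Tadd[of n "?e x" 1] by (simp add: mult_ac)
      also have "\<dots> \<in> U"
        using that P_U[OF X_mem_PS] unfolding I_def by (intro U.mult_mem[of "T ^ Suc n * ?e x"]) auto
      finally show ?thesis
        using that unfolding I_def by simp
    qed
    show "f \<in> I n"
      using W0I[OF PS_one PS_zero, of n] f(1) U(2) unfolding I_def by auto
    show "fps_X ^ n * z \<in> I n" if "z \<in> ?P" for z
    proof -
      have "T ^ n * ?e (fps_X ^ n * z) = ?e z"
        using XTn[of n] by (simp only: e_mult mult.assoc[symmetric] mult.commute[of "T ^ n"]) simp
      also have "\<dots> \<in> U"
        by (rule P_U[OF that])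
      finally show ?thesis
        unfolding I_def using that by (simp add: PS_mult PS_power X_mem_PS)
    qed
    show "y \<in> I n" if "y \<in> ?P" "fps_X * y \<in> I (Suc n)" for y
    proof -
      have "T ^ Suc n * ?e (fps_X * y) = T ^ n * ?e y"
        using Tadd[of n "?e y" 1] by (simp add: e_mult)
      moreover have "T ^ Suc n * ?e (fps_X * y) \<in> U"
        using that unfolding I_def by blast
      ultimately show ?thesis
        using that(1) unfolding I_def by (simp only: mem_Collect_eq)
    qed
    show "1 \<notin> I 1"
      using U(3) unfolding I_def by simp
    show "x \<in> I n \<or> y \<in> I n" if "x \<in> ?P" "y \<in> ?P" "x * y \<in> I (2 * n)" for x y
    proof -
      have "T ^ (2 * n) * ?e (x * y) = (T ^ n * ?e x) * (T ^ n * ?e y)"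
        by (simp only: e_mult mult_2 power_add) (simp only: mult_ac)
      moreover have "T ^ (2 * n) * ?e (x * y) \<in> U"
        using that(3) unfolding I_def by blast
      ultimately have "T ^ n * ?e x \<in> U \<or> T ^ n * ?e y \<in> U"
        using U_prime by (simp only:)
      then show ?thesis
        using that(1,2) unfolding I_def by blast
    qed
  qed
  then show ?thesis by blast
qed

context valuative_filtration
begin

lemma I_antimono: "m \<le> n \<Longrightarrow> x \<in> I n \<Longrightarrow> x \<in> I m"
  by (induction n rule: dec_induct) (auto intro: I_decreasing)

text \<open>
  The ideals of constant terms of the \<open>I n\<close> all contain \<open>f $ 0\<close>, so the valuation of a generator is
  bounded and eventually constant. The common generator \<open>c\<close> is not a unit, because \<open>I n\<close> is a proper
  ideal for \<open>n \<ge> 1\<close>.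
\<close>

lemma constant_terms_stabilize:
  assumes "f $ 0 \<noteq> 0"
  obtains c n\<^sub>0 where "c \<in> W" "c \<noteq> 0" "c \<notin> units"
    "\<And>n x. n\<^sub>0 \<le> n \<Longrightarrow> x \<in> I n \<Longrightarrow> \<exists>r\<in>W. x $ 0 = c * r"
    "\<And>n. n\<^sub>0 \<le> n \<Longrightarrow> \<exists>x\<in>I n. x $ 0 = c"
proof -
  define P where "P n k \<longleftrightarrow> (\<exists>x\<in>I n. x $ 0 \<noteq> 0 \<and> ord (x $ 0) = k)" for n k
  define k where "k n = (LEAST k. P n k)" for n
  have P_f: "P n (ord (f $ 0))" for n
    unfolding P_def using f_I assms by blast
  have P_k: "P n (k n)" for n
    unfolding k_def using P_f by (rule LeastI)
  have k_le: "k n \<le> j" if "P n j" for n j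
    unfolding k_def using that by (rule Least_le)
  have "\<exists>n. 1 \<le> n \<and> (\<forall>m. 1 \<le> m \<longrightarrow> k m \<le> k n)"
    using ex_has_greatest_nat[of "\<lambda>n. 1 \<le> n" 1 k "Suc (ord (f $ 0))"] k_le[OF P_f]
    by (auto simp: less_Suc_eq_le)
  then obtain n\<^sub>0 where n0: "1 \<le> n\<^sub>0" "\<And>m. 1 \<le> m \<Longrightarrow> k m \<le> k n\<^sub>0"
    by blast
  have const: "k n = k n\<^sub>0" if "n\<^sub>0 \<le> n" for n
  proof -
    have "P n\<^sub>0 (k n)"
      using P_k[of n] I_antimono[OF that] unfolding P_def by blast
    then show ?thesis
      using k_le n0 that by (meson le_antisym le_trans)
  qed
  define c where "c = uniformizer ^ k n\<^sub>0"
  have c: "c \<in> W" "c \<noteq> 0"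
    unfolding c_def using uniformizer by (auto intro: power_mem)
  have ord_c: "ord c = k n\<^sub>0"
    using ord_eq[OF units_one, of "k n\<^sub>0"] unfolding c_def by simp
  have gen: "\<exists>x\<in>I n. x $ 0 = c" if n: "n\<^sub>0 \<le> n" for n
  proof -
    obtain x where x: "x \<in> I n" "x $ 0 \<noteq> 0" "ord (x $ 0) = k n\<^sub>0"
      using P_k[of n] const[OF n] unfolding P_def by auto
    obtain u l where u: "u \<in> units" "x $ 0 = u * uniformizer ^ l" "ord (x $ 0) = l"
      using ord_decomp nth_mem_PS[OF I_sub[OF x(1)]] x(2) by blast
    have "x * fps_const (inverse u) \<in> I n"
      using I_mult[OF x(1)] const_mem_PS u(1) unfolding units_def by simp
    moreover have "(x * fps_const (inverse u)) $ 0 = c"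
      using u x(3) unfolding units_def c_def by simp
    ultimately show ?thesis by blast
  qed
  have "c \<notin> units"
  proof
    assume cu: "c \<in> units"
    obtain x where x: "x \<in> I n\<^sub>0" "x $ 0 = c"
      using gen by blast
    then have "x * inverse x \<in> I n\<^sub>0"
      using inverse_mem_PS I_sub I_mult cu by simp
    then show False
      using one_notin_I I_antimono[OF n0(1)] inverse_mult_eq_1'[of x] x(2) c(2) by simp
  qed
  moreover have "\<exists>r\<in>W. x $ 0 = c * r" if "n\<^sub>0 \<le> n" "x \<in> I n" for n x
  proof (cases "x $ 0 = 0")
    case True
    then show ?thesis by (intro bexI[of _ 0]) (auto simp: zero_mem)
  next
    case False
    then have "P n (ord (x $ 0))"
      unfolding P_def using that(2) by blast
    then have "ord c \<le> ord (x $ 0)"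
      using k_le const[OF that(1)] ord_c by metis
    then show ?thesis
      using dvd_of_ord_le c nth_mem_PS[OF I_sub[OF that(2)]] False by blast
  qed
  ultimately show thesis
    using that c gen by blast
qed

text \<open>
  Division with respect to \<open>g\<close> works coefficient by coefficient: subtracting a multiple of \<open>g\<close> clears
  the constant term, and cancelling \<open>X\<close> lowers the index of the filtration by one. It continues as long
  as the index is at least \<open>n\<^sub>0\<close>.
\<close>

lemma division_step:
  assumes c: "c \<noteq> 0" "\<forall>n\<ge>n\<^sub>0. \<forall>x\<in>I n. \<exists>r\<in>W. x $ 0 = c * r"
    and "x \<in> I (n\<^sub>0 + m)" "g \<in> I (n\<^sub>0 + m)" "g $ 0 = c"
  shows "\<exists>r\<in>power_series_over W. fps_X ^ Suc m dvd x - g * r"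
  using assms(3,4)
proof (induction m arbitrary: x)
  case 0
  obtain r where r: "r \<in> W" "x $ 0 = c * r"
    using c(2) 0 by auto
  have "fps_X ^ Suc 0 dvd x - g * fps_const r"
    unfolding X_pow_dvd_iff using r assms(5) by simp
  then show ?case
    using const_mem_PS[OF r(1)] by blast
next
  case (Suc m)
  obtain r where r: "r \<in> W" "x $ 0 = c * r"
    using c(2) Suc.prems by (metis le_add1)
  have "fps_X ^ 1 dvd x - g * fps_const r"
    unfolding X_pow_dvd_iff using r assms(5) by simp
  moreover have mem: "x - g * fps_const r \<in> I (Suc (n\<^sub>0 + m))"
    using Suc.prems const_mem_PS[OF r(1)] by (simp add: I_diff I_mult)
  ultimately obtain z where z: "z \<in> power_series_over W" "x - g * fps_const r = fps_X * z"
    using X_pow_dvd_PS[of "x - g * fps_const r" 1] I_sub by (metis power_one_right)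
  have "z \<in> I (n\<^sub>0 + m)"
    using X_cancel_I[OF z(1)] mem unfolding z(2) by blast
  moreover have "g \<in> I (n\<^sub>0 + m)"
    using Suc.prems(2) I_antimono[of "n\<^sub>0 + m" "n\<^sub>0 + Suc m"] by simp
  ultimately obtain s where s: "s \<in> power_series_over W" "fps_X ^ Suc m dvd z - g * s"
    using Suc.IH by blast
  have "x - g * (fps_const r + fps_X * s) = fps_X * (z - g * s)"
    using z(2) by (simp add: algebra_simps)
  moreover have "fps_X ^ Suc (Suc m) dvd fps_X * (z - g * s)"
    using s(2) by (subst power_Suc) (rule mult_dvd_mono[OF dvd_refl])
  moreover have "fps_const r + fps_X * s \<in> power_series_over W"
    using r(1) s(1) by (intro PS_add PS_mult const_mem_PS X_mem_PS)
  ultimately show ?case by metis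
qed

text \<open>
  Elements of \<open>I (n\<^sub>0 + m)\<close> with constant term \<open>c\<close> are unique up to units and up to \<open>X ^ m\<close>, by
  \<open>division_step\<close>. So they can be chosen to converge as \<open>m\<close> grows, and the limit \<open>g\<close> lies in every \<open>I n\<close>.
  It generates the intersection of the \<open>I n\<close>, which contains \<open>f\<close>; the last property is Chevalley's
  theorem for this filtration.
\<close>

lemma ex_limit_generator:
  assumes f0: "f $ 0 \<noteq> 0"
  obtains g n\<^sub>0 where "g \<in> power_series_over W" "g $ 0 \<noteq> 0" "g $ 0 \<notin> units"
    "f * inverse g \<in> power_series_over W" "f = g * (f * inverse g)"
    "\<And>N x. x \<in> I (n\<^sub>0 + N) \<Longrightarrow> \<exists>r\<in>power_series_over W. fps_X ^ Suc N dvd x - g * r"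
proof -
  obtain c n\<^sub>0 where c: "c \<in> W" "c \<noteq> 0" "c \<notin> units"
    and dvd: "\<forall>n\<ge>n\<^sub>0. \<forall>x\<in>I n. \<exists>r\<in>W. x $ 0 = c * r"
    and gen: "\<And>n. n\<^sub>0 \<le> n \<Longrightarrow> \<exists>x\<in>I n. x $ 0 = c"
    using constant_terms_stabilize[OF f0] by metis
  have step: "\<exists>h. (h \<in> I (n\<^sub>0 + Suc m) \<and> h $ 0 = c) \<and> fps_X ^ m dvd h - g"
    if g: "g \<in> I (n\<^sub>0 + m) \<and> g $ 0 = c" for g m
  proof -
    obtain y where y: "y \<in> I (n\<^sub>0 + Suc m)" "y $ 0 = c"
      using gen[of "n\<^sub>0 + Suc m"] by auto
    have "y \<in> I (n\<^sub>0 + m)"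
      using I_antimono[OF _ y(1), of "n\<^sub>0 + m"] by simp
    then obtain r where r: "r \<in> power_series_over W" "fps_X ^ Suc m dvd g - y * r"
      using division_step[OF c(2) dvd] g y(2) by blast
    have "(g - y * r) $ 0 = 0"
      using r(2) unfolding X_pow_dvd_iff by blast
    then have "r $ 0 = 1"
      using g y(2) c(2) by simp
    then have "y * r \<in> I (n\<^sub>0 + Suc m) \<and> (y * r) $ 0 = c"
      using y r(1) I_mult by simp
    moreover have "fps_X ^ m dvd y * r - g"
      using X_pow_dvd_sym[OF X_pow_dvd_mono[OF r(2), of m]] by simp
    ultimately show ?thesis by blast
  qed
  have "\<exists>h. h \<in> I (n\<^sub>0 + 0) \<and> h $ 0 = c"
    using gen[of "n\<^sub>0 + 0"] by auto
  from dependent_nat_choice[of "\<lambda>m h. h \<in> I (n\<^sub>0 + m) \<and> h $ 0 = c"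
      "\<lambda>m g h. fps_X ^ m dvd h - g", OF this step]
  obtain G where G: "\<And>m. G m \<in> I (n\<^sub>0 + m)" "\<And>m. G m $ 0 = c" "\<And>m. fps_X ^ m dvd G (Suc m) - G m"
    by blast
  obtain g where g: "\<And>n. fps_X ^ n dvd g - G n" "\<And>i. g $ i = G (Suc i) $ i"
    using X_adic_limit[OF G(3)] by blast
  have g_PS: "g \<in> power_series_over W"
    using nth_mem_PS[OF I_sub[OF G(1)]] unfolding power_series_over_def by (simp add: g(2))
  have g0: "g $ 0 = c"
    using g(2)[of 0] G(2) by simp
  have g_I: "g \<in> I n" for n
  proof -
    obtain z where z: "z \<in> power_series_over W" "g - G n = fps_X ^ n * z"
      using X_pow_dvd_PS[OF _ g(1)] g_PS I_sub[OF G(1)] PS_diff by blast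
    have "fps_X ^ n * - z \<in> I n"
      using X_pow_I[of "- z" n] PS_diff[OF PS_zero z(1)] by simp
    moreover have "G n \<in> I n"
      using I_antimono[OF _ G(1)[of n], of n] by simp
    moreover have "g = G n - fps_X ^ n * - z"
      using z(2) by (simp add: algebra_simps)
    ultimately show ?thesis
      using I_diff by metis
  qed
  have quot: "\<exists>r\<in>power_series_over W. fps_X ^ Suc N dvd x - g * r" if "x \<in> I (n\<^sub>0 + N)" for x N
    using division_step[OF c(2) dvd that g_I g0] by blast
  have "\<exists>r\<in>power_series_over W. fps_X ^ n dvd f - g * r" for n
    using quot[OF f_I, of n] X_pow_dvd_mono[of "Suc n" _ n] by (metis le_SucI le_refl)
  then have "f * inverse g \<in> power_series_over W" "f = g * (f * inverse g)"
    using dvd_closed[of g f] g0 c(2) by auto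
  then show thesis
    using that[OF g_PS _ _ _ _ quot] g0 c by blast
qed

end

section \<open>Factors of nearby power series over a discrete valuation ring\<close>

context discrete_valuation_subring
begin

text \<open>
  If \<open>p * q\<close> is close to \<open>f\<close>, it lies in some \<open>I (2 * n)\<close>, so one of the factors lies in \<open>I n\<close>, all of whose
  elements are close to multiples of \<open>g\<close>.
\<close>

lemma ex_approximate_prime_factor:
  assumes f: "f \<in> power_series_over W" "f $ 0 \<noteq> 0" "f $ 0 \<notin> units"
  obtains g f' where "g \<in> power_series_over W" "g $ 0 \<noteq> 0" "g $ 0 \<notin> units"
    "f' \<in> power_series_over W" "f = g * f'"
    "\<And>N. \<exists>n. \<forall>p\<in>power_series_over W. \<forall>q\<in>power_series_over W. fps_X ^ n dvd p * q - f \<longrightarrow>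
      (\<exists>r\<in>power_series_over W. fps_X ^ N dvd p - g * r) \<or>
      (\<exists>r\<in>power_series_over W. fps_X ^ N dvd q - g * r)"
proof -
  obtain I where "valuative_filtration W f I"
    using ex_valuative_filtration[OF f] by blast
  then interpret valuative_filtration W f I .
  obtain g n\<^sub>0 where g: "g \<in> power_series_over W" "g $ 0 \<noteq> 0" "g $ 0 \<notin> units"
    "f * inverse g \<in> power_series_over W" "f = g * (f * inverse g)"
    and quot: "\<And>N x. x \<in> I (n\<^sub>0 + N) \<Longrightarrow> \<exists>r\<in>power_series_over W. fps_X ^ Suc N dvd x - g * r"
    using ex_limit_generator[OF f(2)] by blast
  have "p \<in> I (n\<^sub>0 + N) \<or> q \<in> I (n\<^sub>0 + N)"
    if pq: "p \<in> power_series_over W" "q \<in> power_series_over W" "fps_X ^ (2 * (n\<^sub>0 + N)) dvd p * q - f" for p q N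
  proof -
    obtain z where z: "z \<in> power_series_over W" "p * q - f = fps_X ^ (2 * (n\<^sub>0 + N)) * z"
      using X_pow_dvd_PS[OF _ pq(3)] PS_diff PS_mult pq f(1) by blast
    have "fps_X ^ (2 * (n\<^sub>0 + N)) * - z \<in> I (2 * (n\<^sub>0 + N))"
      using X_pow_I[of "- z"] PS_diff[OF PS_zero z(1)] by simp
    moreover have "p * q = f - fps_X ^ (2 * (n\<^sub>0 + N)) * - z"
      using z(2) by (simp add: algebra_simps)
    ultimately have "p * q \<in> I (2 * (n\<^sub>0 + N))"
      using I_diff f_I by metis
    then show ?thesis
      using prime_I pq by blast
  qed
  then have "\<exists>n. \<forall>p\<in>power_series_over W. \<forall>q\<in>power_series_over W. fps_X ^ n dvd p * q - f \<longrightarrow>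
      (\<exists>r\<in>power_series_over W. fps_X ^ N dvd p - g * r) \<or>
      (\<exists>r\<in>power_series_over W. fps_X ^ N dvd q - g * r)" for N
    using quot X_pow_dvd_mono[of "Suc N" _ N] by (meson le_SucI le_refl)
  then show thesis
    using that g by blast
qed

text \<open>
  Induction on the valuation of \<open>f $ 0\<close>: split off from \<open>f\<close> the factor \<open>g\<close> of the previous lemma. Each
  candidate \<open>F\<close> for the cofactor \<open>f'\<close> yields two candidates for \<open>f\<close>, namely \<open>g * F\<close> if \<open>p\<close> is close to a
  multiple of \<open>g\<close>, and \<open>F\<close> if \<open>q\<close> is.
\<close>

lemma finitely_many_approximate_factors:
  assumes "f \<in> power_series_over W" "f $ 0 \<noteq> 0"
  shows "\<exists>\<Phi>. finite \<Phi> \<and> (\<forall>N. \<exists>n. \<forall>p\<in>power_series_over W. \<forall>q\<in>power_series_over W.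
    fps_X ^ n dvd p * q - f \<longrightarrow>
    (\<exists>F\<in>\<Phi>. \<exists>u\<in>power_series_over W. u $ 0 \<in> units \<and> fps_X ^ N dvd p - F * u))"
  using assms
proof (induction "ord (f $ 0)" arbitrary: f rule: less_induct)
  case less
  let ?P = "power_series_over W"
  have f0: "f $ 0 \<in> W"
    using less.prems nth_mem_PS by blast
  show ?case
  proof (cases "f $ 0 \<in> units")
    case True
    have "p $ 0 \<in> units" if "p \<in> ?P" "q \<in> ?P" "fps_X ^ Suc N dvd p * q - f" for p q N
    proof -
      have "p $ 0 * q $ 0 = f $ 0"
        using that(3) unfolding X_pow_dvd_iff by auto
      then show ?thesis
        using units_factor[of "p $ 0" "q $ 0"] True nth_mem_PS that by simp
    qed
    then show ?thesis
      by (intro exI[of _ "{1}"] conjI allI, simp, rename_tac N, rule_tac x = "Suc N" in exI)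
        (auto intro!: bexI)
  next
    case False
    obtain g f' where g: "g \<in> ?P" "g $ 0 \<noteq> 0" "g $ 0 \<notin> units" and f': "f' \<in> ?P" "f = g * f'"
      and prime: "\<And>N. \<exists>n. \<forall>p\<in>?P. \<forall>q\<in>?P. fps_X ^ n dvd p * q - f \<longrightarrow>
        (\<exists>r\<in>?P. fps_X ^ N dvd p - g * r) \<or> (\<exists>r\<in>?P. fps_X ^ N dvd q - g * r)"
      using ex_approximate_prime_factor[OF less.prems False] by metis
    have f'0: "f' $ 0 \<noteq> 0" "f' $ 0 \<in> W" "g $ 0 \<in> W"
      using less.prems(2) f' g(1) nth_mem_PS by auto
    have "ord (f $ 0) = ord (g $ 0) + ord (f' $ 0)"
      using ord_mult[of "g $ 0" "f' $ 0"] f' f'0 g(2) by simp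
    moreover have "ord (g $ 0) \<noteq> 0"
      using ord_eq_0_iff g f'0 by blast
    ultimately have "ord (f' $ 0) < ord (f $ 0)"
      by simp
    then obtain \<Phi> where \<Phi>: "finite \<Phi>" "\<And>N. \<exists>n. \<forall>p\<in>?P. \<forall>q\<in>?P. fps_X ^ n dvd p * q - f' \<longrightarrow>
        (\<exists>F\<in>\<Phi>. \<exists>u\<in>?P. u $ 0 \<in> units \<and> fps_X ^ N dvd p - F * u)"
      using less.hyps[OF _ f'(1) f'0(1)] by blast
    have "\<exists>n. \<forall>p\<in>?P. \<forall>q\<in>?P. fps_X ^ n dvd p * q - f \<longrightarrow>
        (\<exists>F\<in>\<Phi> \<union> (*) g ` \<Phi>. \<exists>u\<in>?P. u $ 0 \<in> units \<and> fps_X ^ N dvd p - F * u)" for N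
    proof -
      obtain m where m: "\<And>p q. \<lbrakk>p \<in> ?P; q \<in> ?P; fps_X ^ m dvd p * q - f'\<rbrakk> \<Longrightarrow>
          \<exists>F\<in>\<Phi>. \<exists>u\<in>?P. u $ 0 \<in> units \<and> fps_X ^ N dvd p - F * u"
        using \<Phi>(2)[of N] by blast
      obtain n where n: "\<And>p q. \<lbrakk>p \<in> ?P; q \<in> ?P; fps_X ^ n dvd p * q - f\<rbrakk> \<Longrightarrow>
          (\<exists>r\<in>?P. fps_X ^ max m N dvd p - g * r) \<or> (\<exists>r\<in>?P. fps_X ^ max m N dvd q - g * r)"
        using prime[of "max m N"] by blast
      \<comment> \<open>A factor \<open>g\<close> of one of \<open>x\<close>, \<open>y\<close> can be cancelled against that of \<open>f\<close>.\<close>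
      have cancel: "fps_X ^ m dvd r * y - f'"
        if "fps_X ^ max n m dvd x * y - f" "fps_X ^ max m N dvd x - g * r" for x y r
      proof -
        have "fps_X ^ m dvd x * y - f" "fps_X ^ m dvd x - g * r"
          using that X_pow_dvd_mono by (meson max.cobounded1 max.cobounded2)+
        then have "fps_X ^ m dvd (x * y - f) - (x - g * r) * y"
          by (rule dvd_diff[OF _ dvd_mult2])
        also have "(x * y - f) - (x - g * r) * y = g * (r * y - f')"
          unfolding f'(2) by (simp add: algebra_simps)
        finally show ?thesis
          by (rule X_pow_dvd_cancel[OF g(2)])
      qed
      have "\<exists>F\<in>\<Phi> \<union> (*) g ` \<Phi>. \<exists>u\<in>?P. u $ 0 \<in> units \<and> fps_X ^ N dvd p - F * u"
        if pq: "p \<in> ?P" "q \<in> ?P" "fps_X ^ max n m dvd p * q - f" for p q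
      proof -
        have "fps_X ^ n dvd p * q - f"
          using pq(3) X_pow_dvd_mono by (meson max.cobounded1)
        then consider r where "r \<in> ?P" "fps_X ^ max m N dvd p - g * r"
          | r where "r \<in> ?P" "fps_X ^ max m N dvd q - g * r"
          using n pq by blast
        then show ?thesis
        proof cases
          case (1 r)
          obtain F u where F: "F \<in> \<Phi>" "u \<in> ?P" "u $ 0 \<in> units" "fps_X ^ N dvd r - F * u"
            using m[OF 1(1) pq(2) cancel[OF pq(3) 1(2)]] by blast
          have "fps_X ^ N dvd p - g * r"
            using 1(2) X_pow_dvd_mono by (meson max.cobounded2)
          moreover have "fps_X ^ N dvd g * r - (g * F) * u"
            using dvd_mult[OF F(4), of g] by (simp add: algebra_simps)
          ultimately have "fps_X ^ N dvd p - (g * F) * u"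
            by (rule X_pow_dvd_trans)
          then show ?thesis
            using F by blast
        next
          case (2 r)
          have "fps_X ^ max n m dvd q * p - f"
            using pq(3) by (simp add: mult.commute)
          then have "fps_X ^ m dvd p * r - f'"
            using cancel[OF _ 2(2)] by (metis mult.commute)
          then show ?thesis
            using m[OF pq(1) 2(1)] by blast
        qed
      qed
      then show ?thesis by blast
    qed
    then show ?thesis
      using \<Phi>(1) by (intro exI[of _ "\<Phi> \<union> (*) g ` \<Phi>"]) auto
  qed
qed

end

section \<open>Intersections of discrete valuation rings\<close>

text \<open>
  The localizations of a Krull domain at its height-one primes have these two properties; the domain
  itself is then the intersection.
\<close>

locale krull_family =
  fixes \<V> :: "'k::field set set"
  assumes dvr: "V \<in> \<V> \<Longrightarrow> discrete_valuation_subring V"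
    and finite_support: "\<lbrakk>x \<in> \<Inter>\<V>; x \<noteq> 0\<rbrakk> \<Longrightarrow> finite {V \<in> \<V>. inverse x \<notin> V}"
begin

sublocale subring_of_field "\<Inter>\<V>"
proof
  have sub: "unital_subring V" if "V \<in> \<V>" for V
    using dvr[OF that] by (simp add: discrete_valuation_subring_def subring_of_field_def)
  show "1 \<in> \<Inter>\<V>"
    using sub unital_subring.one_mem by blast
  show "x - y \<in> \<Inter>\<V>" "x * y \<in> \<Inter>\<V>" if "x \<in> \<Inter>\<V>" "y \<in> \<Inter>\<V>" for x y
    using that sub unital_subring.diff_mem unital_subring.mult_mem by blast+
qed

abbreviation "R \<equiv> \<Inter>\<V>"
abbreviation "units_in \<equiv> subring_of_field.units"

lemma subring_of_field_member: "V \<in> \<V> \<Longrightarrow> subring_of_field V"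
  using dvr by (simp add: discrete_valuation_subring_def)

lemma R_sub: "V \<in> \<V> \<Longrightarrow> x \<in> power_series_over R \<Longrightarrow> x \<in> power_series_over V"
  by (auto simp: power_series_over_def)

lemma units_sub: "V \<in> \<V> \<Longrightarrow> x \<in> units \<Longrightarrow> x \<in> units_in V"
  using subring_of_field.units_def[OF subring_of_field_member] unfolding units_def by auto

text \<open>
  The series \<open>F V\<close> prescribe the classes of a factor up to local units. This is what makes an approximate
  factor unique up to units of \<open>R[[X]]\<close>. Where \<open>f $ 0\<close> is invertible there is only one class.
\<close>

definition approx_factor :: "'k fps \<Rightarrow> ('k set \<Rightarrow> 'k fps) \<Rightarrow> nat \<Rightarrow> 'k fps \<Rightarrow> bool" where
  "approx_factor f F N p \<longleftrightarrow> p \<in> power_series_over R \<and> p $ 0 \<notin> units \<and>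
     (\<exists>q\<in>power_series_over R. q $ 0 \<notin> units \<and> fps_X ^ N dvd p * q - f) \<and>
     (\<forall>V\<in>\<V>. inverse (f $ 0) \<notin> V \<longrightarrow>
       (\<exists>u\<in>power_series_over V. u $ 0 \<in> units_in V \<and> fps_X ^ N dvd p - F V * u))"

lemma approx_factor_mono: "approx_factor f F N p \<Longrightarrow> M \<le> N \<Longrightarrow> approx_factor f F M p"
  unfolding approx_factor_def by (meson X_pow_dvd_mono)

lemma approx_factor_mult_unit:
  assumes p: "approx_factor f F N p" and r: "r \<in> power_series_over R" "r $ 0 \<in> units"
  shows "approx_factor f F N (p * r)"
proof -
  obtain q where q: "q \<in> power_series_over R" "q $ 0 \<notin> units" "fps_X ^ N dvd p * q - f"
    using p unfolding approx_factor_def by blast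
  have pR: "p \<in> power_series_over R" "p $ 0 \<notin> units"
    using p unfolding approx_factor_def by blast+
  have r0: "r $ 0 \<noteq> 0"
    using r(2) unfolding units_def by blast
  have inv: "inverse r \<in> power_series_over R" "inverse r $ 0 \<in> R"
    using inverse_mem_PS[OF r] nth_mem_PS by blast+
  have "(p * r) * (q * inverse r) = p * q * (r * inverse r)"
    by (simp only: mult_ac)
  then have "(p * r) * (q * inverse r) = p * q"
    by (simp only: inverse_mult_eq_1'[OF r0] mult_1_right)
  then have "fps_X ^ N dvd (p * r) * (q * inverse r) - f"
    using q(3) by (simp only:)
  moreover have "(p * r) $ 0 \<notin> units"
    using units_factor[of "p $ 0" "r $ 0"] pR nth_mem_PS r(1) by auto
  moreover have "(q * inverse r) $ 0 \<notin> units"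
    using units_factor[of "q $ 0" "inverse r $ 0"] q nth_mem_PS inv(2) by auto
  moreover have "\<exists>u\<in>power_series_over V. u $ 0 \<in> units_in V \<and> fps_X ^ N dvd p * r - F V * u"
    if V: "V \<in> \<V>" "inverse (f $ 0) \<notin> V" for V
  proof -
    interpret V: subring_of_field V
      by (rule subring_of_field_member[OF V(1)])
    obtain u where u: "u \<in> power_series_over V" "u $ 0 \<in> V.units" "fps_X ^ N dvd p - F V * u"
      using p V unfolding approx_factor_def by blast
    have "fps_X ^ N dvd (p - F V * u) * r"
      using u(3) by (rule dvd_mult2)
    then have "fps_X ^ N dvd p * r - F V * (u * r)"
      by (simp add: algebra_simps)
    then show ?thesis
      using V.PS_mult[OF u(1) R_sub[OF V(1) r(1)]] V.units_mult[OF u(2) units_sub[OF V(1) r(2)]]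
      by (intro bexI[of _ "u * r"]) auto
  qed
  ultimately show ?thesis
    unfolding approx_factor_def using PS_mult pR(1) r(1) q(1) inv(1) by blast
qed

text \<open>
  Where \<open>f $ 0\<close> is invertible, so is \<open>p\<close>. At the other rings \<open>p\<close> and \<open>p'\<close> are both close to \<open>F V\<close> times
  a unit, and \<open>F V\<close>, whose constant term does not vanish, cancels from the quotient.
\<close>

lemma approx_factor_ratio:
  assumes p: "approx_factor f F (Suc N) p" and p': "approx_factor f F (Suc N) p'"
    and f0: "f $ 0 \<noteq> 0" and "i \<le> N"
  shows "(p' * inverse p) $ i \<in> R"
proof
  fix V assume V: "V \<in> \<V>"
  interpret V: subring_of_field V
    by (rule subring_of_field_member[OF V])
  obtain q where q: "q \<in> power_series_over R" "fps_X ^ Suc N dvd p * q - f"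
    using p unfolding approx_factor_def by blast
  have pR: "p \<in> power_series_over R" "p' \<in> power_series_over R"
    using p p' unfolding approx_factor_def by blast+
  have pq: "p $ 0 * q $ 0 = f $ 0"
    using q(2) unfolding X_pow_dvd_iff by auto
  then have p0: "p $ 0 \<noteq> 0" "q $ 0 \<noteq> 0"
    using f0 by auto
  have mem: "p $ 0 \<in> V" "q $ 0 \<in> V" "f $ 0 \<in> V"
    using V.nth_mem_PS R_sub[OF V] pR q(1) V.mult_mem pq by metis+
  show "(p' * inverse p) $ i \<in> V"
  proof (cases "inverse (f $ 0) \<in> V")
    case True
    then have "p $ 0 * q $ 0 \<in> V.units"
      using pq f0 mem unfolding V.units_def by simp
    then have "inverse p \<in> power_series_over V"
      using V.inverse_mem_PS R_sub[OF V pR(1)] V.units_factor mem by blast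
    then show ?thesis
      using V.PS_mult R_sub[OF V pR(2)] V.nth_mem_PS by blast
  next
    case False
    obtain u where u: "u \<in> power_series_over V" "u $ 0 \<in> V.units" "fps_X ^ Suc N dvd p - F V * u"
      using p V False unfolding approx_factor_def by blast
    obtain u' where u': "u' \<in> power_series_over V" "u' $ 0 \<in> V.units" "fps_X ^ Suc N dvd p' - F V * u'"
      using p' V False unfolding approx_factor_def by blast
    have u0: "u $ 0 \<noteq> 0"
      using u(2) unfolding V.units_def by blast
    have inv: "p * inverse p = 1" "u * inverse u = 1"
      using inverse_mult_eq_1' p0(1) u0 by blast+
    have "fps_X ^ Suc N dvd (p' - F V * u') * u - (p - F V * u) * u'"
      using u(3) u'(3) by (rule dvd_diff[OF dvd_mult2 dvd_mult2, rotated])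
    also have "(p' - F V * u') * u - (p - F V * u) * u' = p' * u - p * u'"
      by (simp add: algebra_simps)
    also have "\<dots> = (p * u) * (p' * inverse p - u' * inverse u)"
    proof -
      have "(p * u) * (p' * inverse p - u' * inverse u)
          = p' * u * (p * inverse p) - p * u' * (u * inverse u)"
        by (simp only: right_diff_distrib mult_ac)
      then show ?thesis by (simp only: inv mult_1_right)
    qed
    finally have "fps_X ^ Suc N dvd (p * u) * (p' * inverse p - u' * inverse u)" .
    moreover have "(p * u) $ 0 \<noteq> 0"
      using p0(1) u0 by simp
    ultimately have "fps_X ^ Suc N dvd p' * inverse p - u' * inverse u"
      using X_pow_dvd_cancel by blast
    then have "(p' * inverse p) $ i = (u' * inverse u) $ i"
      using \<open>i \<le> N\<close> unfolding X_pow_dvd_iff by simp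
    then show ?thesis
      using V.PS_mult[OF u'(1) V.inverse_mem_PS[OF u(1,2)]] V.nth_mem_PS by metis
  qed
qed

lemma approx_factor_unique_up_to_units:
  assumes p: "approx_factor f F (Suc N) p" and p': "approx_factor f F (Suc N) p'"
    and f0: "f $ 0 \<noteq> 0"
  shows "\<exists>r\<in>power_series_over R. r $ 0 \<in> units \<and> fps_X ^ Suc N dvd p' - p * r"
proof -
  have nz: "p $ 0 \<noteq> 0" if a: "approx_factor f F (Suc N) p" for p
  proof -
    obtain q where "fps_X ^ Suc N dvd p * q - f"
      using a unfolding approx_factor_def by blast
    then have "p $ 0 * q $ 0 = f $ 0"
      unfolding X_pow_dvd_iff by auto
    then show ?thesis using f0 by auto
  qed
  define r where "r = fps_cutoff (Suc N) (p' * inverse p)"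
  have r: "r \<in> power_series_over R"
    unfolding r_def power_series_over_def
    using approx_factor_ratio[OF p p' f0] zero_mem by (simp add: less_Suc_eq_le del: Inter_iff)
  have r0: "r $ 0 = p' $ 0 * inverse (p $ 0)"
    unfolding r_def by simp
  have "inverse (r $ 0) = p $ 0 * inverse (p' $ 0)"
    unfolding r0 by simp
  then have "inverse (r $ 0) \<in> R"
    using approx_factor_ratio[OF p' p f0, of 0] by simp
  then have unit: "r $ 0 \<in> units"
    unfolding units_def using nth_mem_PS[OF r, of 0] nz[OF p] nz[OF p'] r0 by simp
  have "fps_X ^ Suc N dvd p' * inverse p - r"
    unfolding r_def X_pow_dvd_iff by simp
  then have "fps_X ^ Suc N dvd p * (p' * inverse p - r)"
    by (rule dvd_mult)
  then have "fps_X ^ Suc N dvd p' * (p * inverse p) - p * r"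
    by (simp only: right_diff_distrib mult_ac)
  then have "fps_X ^ Suc N dvd p' - p * r"
    by (simp only: inverse_mult_eq_1'[OF nz[OF p]] mult_1_right)
  then show ?thesis
    using r unit by blast
qed

text \<open>
  To each precision \<open>N\<close> belongs a choice of local types \<open>F V\<close>, one for each of the finitely many
  rings at which \<open>f $ 0\<close> is not invertible. There are finitely many choices, so one of them occurs for
  infinitely many \<open>N\<close>.
\<close>

lemma ex_consistent_approx_factors:
  assumes f: "f \<in> power_series_over R" "f $ 0 \<noteq> 0"
    and red: "\<And>n. \<exists>p\<in>power_series_over R. \<exists>q\<in>power_series_over R.
      p $ 0 \<notin> units \<and> q $ 0 \<notin> units \<and> fps_X ^ n dvd p * q - f"
  shows "\<exists>F. \<forall>N. \<exists>p. approx_factor f F N p"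
proof -
  define \<S> where "\<S> = {V \<in> \<V>. inverse (f $ 0) \<notin> V}"
  have fin: "finite \<S>"
    unfolding \<S>_def using finite_support nth_mem_PS[OF f(1)] f(2) by blast
  define near where "near V \<Phi> N n \<longleftrightarrow> (\<forall>p\<in>power_series_over V. \<forall>q\<in>power_series_over V.
      fps_X ^ n dvd p * q - f \<longrightarrow>
      (\<exists>F\<in>\<Phi>. \<exists>u\<in>power_series_over V. u $ 0 \<in> units_in V \<and> fps_X ^ N dvd p - F * u))" for V \<Phi> N n
  have "\<exists>\<Phi>. finite \<Phi> \<and> (\<forall>N. \<exists>n. near V \<Phi> N n)" if "V \<in> \<S>" for V
    unfolding near_def using that f R_sub unfolding \<S>_def
    by (intro discrete_valuation_subring.finitely_many_approximate_factors[OF dvr]) auto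
  then obtain \<Phi> where \<Phi>: "\<And>V. V \<in> \<S> \<Longrightarrow> finite (\<Phi> V) \<and> (\<forall>N. \<exists>n. near V (\<Phi> V) N n)"
    by metis
  then obtain n where near: "\<And>V N. V \<in> \<S> \<Longrightarrow> near V (\<Phi> V) N (n V N)"
    by metis
  have n: "\<exists>F\<in>\<Phi> V. \<exists>u\<in>power_series_over V. u $ 0 \<in> units_in V \<and> fps_X ^ N dvd p - F * u"
    if "V \<in> \<S>" "p \<in> power_series_over V" "q \<in> power_series_over V" "fps_X ^ n V N dvd p * q - f"
    for V N p q
    using near[OF that(1)] that(2-4) unfolding near_def by blast
  define m where "m N = Max (insert N ((\<lambda>V. n V N) ` \<S>))" for N
  have m: "N \<le> m N" "V \<in> \<S> \<Longrightarrow> n V N \<le> m N" for V N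
    unfolding m_def using fin by (auto intro: Max_ge)
  have "\<exists>p q. p \<in> power_series_over R \<and> q \<in> power_series_over R \<and> p $ 0 \<notin> units \<and> q $ 0 \<notin> units \<and>
      fps_X ^ m N dvd p * q - f" for N
    using red[of "m N"] by blast
  then obtain p q where "\<forall>N. p N \<in> power_series_over R \<and> q N \<in> power_series_over R \<and>
      p N $ 0 \<notin> units \<and> q N $ 0 \<notin> units \<and> fps_X ^ m N dvd p N * q N - f"
    by metis
  then have pq: "\<And>N. p N \<in> power_series_over R" "\<And>N. q N \<in> power_series_over R"
    "\<And>N. p N $ 0 \<notin> units" "\<And>N. q N $ 0 \<notin> units" "\<And>N. fps_X ^ m N dvd p N * q N - f"
    by blast+
  have "\<exists>F. F \<in> PiE \<S> \<Phi> \<and> (\<forall>V\<in>\<S>. \<exists>u\<in>power_series_over V. u $ 0 \<in> units_in V \<and>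
      fps_X ^ N dvd p N - F V * u)" for N
  proof -
    have "\<forall>V\<in>\<S>. \<exists>F. F \<in> \<Phi> V \<and> (\<exists>u\<in>power_series_over V. u $ 0 \<in> units_in V \<and> fps_X ^ N dvd p N - F * u)"
    proof
      fix V assume V: "V \<in> \<S>"
      then have "V \<in> \<V>" unfolding \<S>_def by blast
      then show "\<exists>F. F \<in> \<Phi> V \<and> (\<exists>u\<in>power_series_over V. u $ 0 \<in> units_in V \<and> fps_X ^ N dvd p N - F * u)"
        using n[OF V R_sub R_sub X_pow_dvd_mono[OF pq(5) m(2)[OF V]]] pq(1,2) by blast
    qed
    then obtain F where F: "\<forall>V\<in>\<S>. F V \<in> \<Phi> V \<and>
        (\<exists>u\<in>power_series_over V. u $ 0 \<in> units_in V \<and> fps_X ^ N dvd p N - F V * u)"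
      using bchoice by metis
    then show ?thesis
      by (intro exI[of _ "restrict F \<S>"]) auto
  qed
  then obtain T where T: "\<And>N. T N \<in> PiE \<S> \<Phi>"
    "\<And>N V. V \<in> \<S> \<Longrightarrow> \<exists>u\<in>power_series_over V. u $ 0 \<in> units_in V \<and> fps_X ^ N dvd p N - T N V * u"
    by metis
  have "finite (range T)"
    using finite_PiE[OF fin, of \<Phi>] \<Phi> T(1) by (meson finite_subset image_subsetI)
  then obtain N\<^sub>0 where "infinite {N. T N = T N\<^sub>0}"
    using pigeonhole_infinite[of UNIV T] by auto
  then have cofinal: "\<exists>M\<ge>N. T M = T N\<^sub>0" for N
    unfolding infinite_nat_iff_unbounded_le by auto
  have "\<exists>p. approx_factor f (T N\<^sub>0) N p" for N
  proof -
    obtain M where M: "N \<le> M" "T M = T N\<^sub>0"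
      using cofinal by blast
    have "fps_X ^ M dvd p M * q M - f"
      using X_pow_dvd_mono[OF pq(5) m(1)] .
    moreover have "\<exists>u\<in>power_series_over V. u $ 0 \<in> units_in V \<and> fps_X ^ M dvd p M - T N\<^sub>0 V * u"
      if "V \<in> \<V>" "inverse (f $ 0) \<notin> V" for V
      using T(2)[of V M] that unfolding \<S>_def M(2) by blast
    ultimately have "approx_factor f (T N\<^sub>0) M (p M)"
      unfolding approx_factor_def using pq(1-4) by blast
    then show ?thesis
      using approx_factor_mono[OF _ M(1)] by blast
  qed
  then show ?thesis by blast
qed

text \<open>
  Approximate factors with fixed local types are unique up to units of \<open>R[[X]]\<close>, so each can be adjusted
  to the previous one, and the sequence converges to a factor of \<open>f\<close>.
\<close>

proposition reducibility_closed:
  assumes f: "f \<in> power_series_over R" "f $ 0 \<noteq> 0"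
    and red: "\<And>n. \<exists>p\<in>power_series_over R. \<exists>q\<in>power_series_over R.
      p $ 0 \<notin> units \<and> q $ 0 \<notin> units \<and> fps_X ^ n dvd p * q - f"
  shows "\<exists>p\<in>power_series_over R. \<exists>q\<in>power_series_over R.
      p $ 0 \<notin> units \<and> q $ 0 \<notin> units \<and> f = p * q"
proof -
  obtain F where F: "\<And>N. \<exists>p. approx_factor f F N p"
    using ex_consistent_approx_factors[OF f red] by blast
  have step: "\<exists>h. approx_factor f F (Suc (Suc n)) h \<and> fps_X ^ n dvd h - g"
    if g: "approx_factor f F (Suc n) g" for g n
  proof -
    obtain p where p: "approx_factor f F (Suc (Suc n)) p"
      using F by blast
    have "approx_factor f F (Suc n) p"
      using approx_factor_mono[OF p] by simp
    from approx_factor_unique_up_to_units[OF this g f(2)]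
    obtain r where r: "r \<in> power_series_over R" "r $ 0 \<in> units" "fps_X ^ Suc n dvd g - p * r"
      by blast
    have "fps_X ^ n dvd p * r - g"
      using X_pow_dvd_sym[OF X_pow_dvd_mono[OF r(3), of n]] by simp
    then show ?thesis
      using approx_factor_mult_unit[OF p r(1,2)] by blast
  qed
  from dependent_nat_choice[of "\<lambda>n. approx_factor f F (Suc n)" "\<lambda>n g h. fps_X ^ n dvd h - g", OF F step]
  obtain G where G: "\<And>n. approx_factor f F (Suc n) (G n)" "\<And>n. fps_X ^ n dvd G (Suc n) - G n"
    by blast
  obtain P where P: "\<And>n. fps_X ^ n dvd P - G n" "\<And>i. P $ i = G (Suc i) $ i"
    using X_adic_limit[OF G(2)] by blast
  have GR: "G n \<in> power_series_over R" "G n $ 0 \<notin> units" for n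
    using G(1)[of n] unfolding approx_factor_def by blast+
  have PR: "P \<in> power_series_over R"
    using nth_mem_PS[OF GR(1)] unfolding power_series_over_def by (simp add: P(2) del: Inter_iff)
  have quot: "\<exists>q\<in>power_series_over R. q $ 0 \<notin> units \<and> fps_X ^ n dvd f - P * q" for n
  proof -
    obtain q where q: "q \<in> power_series_over R" "q $ 0 \<notin> units" "fps_X ^ Suc n dvd G n * q - f"
      using G(1) unfolding approx_factor_def by blast
    have "fps_X ^ n dvd G n * q - f"
      using X_pow_dvd_mono[OF q(3), of n] by simp
    moreover have "fps_X ^ n dvd P * q - G n * q"
      using dvd_mult2[OF P(1)[of n], of q] by (simp add: algebra_simps)
    ultimately have "fps_X ^ n dvd f - P * q"
      using X_pow_dvd_trans X_pow_dvd_sym by blast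
    then show ?thesis using q by blast
  qed
  obtain q where q: "q \<in> power_series_over R" "q $ 0 \<notin> units" "fps_X ^ 1 dvd f - P * q"
    using quot[of 1] by blast
  then have f0: "f $ 0 = P $ 0 * q $ 0"
    unfolding X_pow_dvd_iff by simp
  then have P0: "P $ 0 \<noteq> 0"
    using f(2) by auto
  have Q: "f * inverse P \<in> power_series_over R" "f = P * (f * inverse P)"
    using dvd_closed[OF P0] quot by blast+
  have "(f * inverse P) $ 0 = q $ 0"
    using f0 P0 by simp
  moreover have "P $ 0 \<notin> units"
    using P(2)[of 0] GR(2) by simp
  ultimately show ?thesis
    using PR Q q(2) by metis
qed

end

section \<open>Type-class operations and ring records\<close>

lemma ring_on_simps [simp]:
  "carrier (ring_on A) = A" "x \<otimes>\<^bsub>ring_on A\<^esub> y = x * y" "x \<oplus>\<^bsub>ring_on A\<^esub> y = x + y"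
  "\<one>\<^bsub>ring_on A\<^esub> = 1" "\<zero>\<^bsub>ring_on A\<^esub> = 0"
  by (simp_all add: ring_on_def ring_of_type_algebra_def)

lemma whole_ring_eq: "whole_ring = ring_on UNIV"
  by (simp add: ring_on_def ring_of_type_algebra_def)

lemma Units_ring_on: "Units (ring_on A) = {a \<in> A. \<exists>b\<in>A. a * b = 1}"
  unfolding Units_def by (auto simp: mult.commute)

lemma unital_subring_of_ring_on:
  assumes "ring (ring_on A)"
  shows "unital_subring A"
proof -
  interpret ring "ring_on A" by fact
  show ?thesis
  proof
    show "1 \<in> A" using one_closed by simp
    fix x y assume xy: "x \<in> A" "y \<in> A"
    then show "x * y \<in> A" using m_closed[of x y] by simp
    obtain z where "z \<in> A" "y + z = 0"
      using r_neg[of y] a_inv_closed[of y] xy(2) by auto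
    then have "- y \<in> A"
      by (metis group_add_class.minus_unique)
    then show "x - y \<in> A"
      using a_closed[of x "- y"] xy(1) by simp
  qed
qed

lemma retraction_onto_hom:
  assumes "retraction_onto S \<rho>"
  shows "\<rho> (x + y) = \<rho> x + \<rho> y" "\<rho> (x * y) = \<rho> x * \<rho> y" "\<rho> 1 = 1" "\<rho> x \<in> S" "s \<in> S \<Longrightarrow> \<rho> s = s"
  using assms unfolding retraction_onto_def whole_ring_eq by (auto simp: ring_hom_def)

text \<open>
  This is how unique factorization over the retracts enters the proof: irreducible elements are prime.
  Divisibility and units are spelled out because the multiplicative monoid of the ring record lacks \<open>0\<close>,
  whereas \<open>g\<close> and \<open>h\<close> range over all of \<open>A\<close>.
\<close>

lemma irreducible_dvd_mult_in_factorial_domain: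
  assumes fact: "factorial_domain (ring_on A)"
    and mem: "p \<in> A" "g \<in> A" "h \<in> A" and "p \<noteq> 0" and nonunit: "\<not> (\<exists>b\<in>A. p * b = 1)"
    and irred: "\<And>a b. \<lbrakk>a \<in> A; b \<in> A; p = a * b\<rbrakk> \<Longrightarrow> (\<exists>c\<in>A. a * c = 1) \<or> (\<exists>c\<in>A. b * c = 1)"
    and dvd: "k \<in> A" "p * k = g * h"
  shows "(\<exists>c\<in>A. g = p * c) \<or> (\<exists>c\<in>A. h = p * c)"
proof (cases "g = 0 \<or> h = 0")
  case True
  interpret factorial_domain "ring_on A" by fact
  have "0 \<in> A" using zero_closed by simp
  then show ?thesis using True by (metis mult_zero_right)
next
  case False
  interpret factorial_domain "ring_on A" by fact
  have "ring_irreducible\<^bsub>ring_on A\<^esub> p"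
    using mem(1) \<open>p \<noteq> 0\<close> nonunit irred by (intro ring_irreducibleI) (auto simp: Units_ring_on)
  then have "Divisibility.irreducible (mult_of (ring_on A)) p"
    using ring_irreducibleE(3) mem(1) by simp
  then have prime: "Divisibility.prime (mult_of (ring_on A)) p"
    using factorial_monoid.irreducible_prime[OF factorial_monoid_axioms] mem(1) \<open>p \<noteq> 0\<close> by simp
  have "g * h \<noteq> 0"
    using integral[of g h] mem False by auto
  then have "k \<noteq> 0"
    using dvd(2) by auto
  then have "p divides\<^bsub>mult_of (ring_on A)\<^esub> g \<otimes>\<^bsub>mult_of (ring_on A)\<^esub> h"
    unfolding factor_def using dvd by (intro bexI[of _ k]) auto
  then have "p divides\<^bsub>mult_of (ring_on A)\<^esub> g \<or> p divides\<^bsub>mult_of (ring_on A)\<^esub> h"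
    using prime mem False unfolding Divisibility.prime_def by auto
  then show ?thesis
    unfolding factor_def by auto
qed

text \<open>
  Jacobson's criterion: a domain is factorial if proper divisor chains terminate and irreducible elements
  are prime.
\<close>

lemma factorial_domain_whole_ringI:
  fixes \<mu> :: "'b::idom \<Rightarrow> nat"
  assumes measure: "\<And>x y. \<lbrakk>x \<noteq> 0; y \<noteq> 0; \<not> y dvd 1\<rbrakk> \<Longrightarrow> \<mu> x < \<mu> (x * y)"
    and prime: "\<And>p :: 'b. Factorial_Ring.irreducible p \<Longrightarrow> prime_elem p"
  shows "factorial_domain (whole_ring :: 'b ring)"
proof -
  let ?R = "whole_ring :: 'b ring"
  interpret cring ?R by (rule cring_from_type_algebra)
  have "\<one>\<^bsub>?R\<^esub> \<noteq> \<zero>\<^bsub>?R\<^esub>"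
    by (simp add: whole_ring_eq)
  moreover have "a = \<zero>\<^bsub>?R\<^esub> \<or> b = \<zero>\<^bsub>?R\<^esub>" if "a \<otimes>\<^bsub>?R\<^esub> b = \<zero>\<^bsub>?R\<^esub>" for a b
    using that by (simp add: whole_ring_eq)
  ultimately interpret domain ?R
    by (intro domainI is_cring)
  have units: "a \<in> Units (mult_of ?R) \<longleftrightarrow> a dvd 1" for a
  proof -
    have "a \<in> Units (mult_of ?R) \<longleftrightarrow> (\<exists>b. a * b = 1)"
      unfolding Units_mult_eq_Units by (simp add: whole_ring_eq Units_ring_on)
    then show ?thesis
      unfolding dvd_def by metis
  qed
  have divides: "a divides\<^bsub>mult_of ?R\<^esub> b \<longleftrightarrow> a dvd b" if "b \<noteq> 0" for a b
    using that unfolding factor_def whole_ring_eq by (auto simp: dvd_def)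
  have "divisor_chain_condition_monoid (mult_of ?R)"
  proof
    have "{(x, y). x \<in> carrier (mult_of ?R) \<and> y \<in> carrier (mult_of ?R) \<and> properfactor (mult_of ?R) x y}
        \<subseteq> Wellfounded.measure \<mu>"
    proof clarify
      fix x y assume xy: "x \<in> carrier (mult_of ?R)" "y \<in> carrier (mult_of ?R)" "properfactor (mult_of ?R) x y"
      then have nz: "x \<noteq> 0" "y \<noteq> 0"
        by (auto simp: whole_ring_eq)
      then have "x dvd y" "\<not> y dvd x"
        using xy(3) divides unfolding properfactor_def by auto
      then obtain z where z: "y = x * z"
        by (elim dvdE)
      then have "\<not> z dvd 1"
        using \<open>\<not> y dvd x\<close> nz by (metis dvd_mult_cancel_left mult.right_neutral)
      then show "(x, y) \<in> Wellfounded.measure \<mu>"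
        using measure[of x z] z nz by simp
    qed
    then show "wf {(x, y). x \<in> carrier (mult_of ?R) \<and> y \<in> carrier (mult_of ?R) \<and> properfactor (mult_of ?R) x y}"
      by (rule wf_subset[OF wf_measure])
  qed
  moreover have "primeness_condition_monoid (mult_of ?R)"
  proof
    fix p assume p: "p \<in> carrier (mult_of ?R)" "Divisibility.irreducible (mult_of ?R) p"
    then have nz: "p \<noteq> 0" by (simp add: whole_ring_eq)
    have "Factorial_Ring.irreducible p"
    proof (rule Factorial_Ring.irreducibleI)
      show "p \<noteq> 0" "\<not> p dvd 1"
        using nz p(2) units unfolding Divisibility.irreducible_def by auto
      fix a b assume ab: "p = a * b"
      then have "a \<noteq> 0" "b \<noteq> 0" using nz by auto
      show "a dvd 1 \<or> b dvd 1"
      proof (rule disjCI)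
        assume "\<not> b dvd 1"
        then have "\<not> p dvd a"
          unfolding ab using \<open>a \<noteq> 0\<close> by (metis dvd_mult_cancel_left mult.right_neutral)
        then have "properfactor (mult_of ?R) a p"
          unfolding properfactor_def using divides[OF nz] divides[OF \<open>a \<noteq> 0\<close>] ab by simp
        then show "a dvd 1"
          using p(2) \<open>a \<noteq> 0\<close> units unfolding Divisibility.irreducible_def by (simp add: whole_ring_eq)
      qed
    qed
    from prime[OF this] have pe: "prime_elem p" .
    show "Divisibility.prime (mult_of ?R) p"
      unfolding Divisibility.prime_def
    proof (intro conjI ballI impI)
      show "p \<notin> Units (mult_of ?R)"
        using pe units by (simp add: prime_elem_def)
      fix a b assume ab: "a \<in> carrier (mult_of ?R)" "b \<in> carrier (mult_of ?R)"
        "p divides\<^bsub>mult_of ?R\<^esub> a \<otimes>\<^bsub>mult_of ?R\<^esub> b"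
      have nz: "a \<noteq> 0" "b \<noteq> 0"
        using ab(1,2) by (simp_all add: whole_ring_eq)
      have "a \<otimes>\<^bsub>mult_of ?R\<^esub> b = a * b"
        by (simp add: whole_ring_eq)
      then have "p dvd a * b"
        using ab(3) divides[of "a * b" p] nz by simp
      then show "p divides\<^bsub>mult_of ?R\<^esub> a \<or> p divides\<^bsub>mult_of ?R\<^esub> b"
        using pe divides nz by (simp add: prime_elem_dvd_mult_iff)
    qed
  qed
  ultimately have "factorial_monoid (mult_of ?R)"
    using factorial_condition_one by blast
  then show ?thesis
    by (intro factorial_domain.intro domain_axioms)
qed

section \<open>The discrete valuation rings of a Krull domain\<close>

text \<open>
  Every irreducible element of a principal ideal domain generates a nonzero prime ideal. If there is
  only one such ideal, all irreducible elements are associated, and a factorization into irreducibles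
  is a unit times a power.
\<close>

lemma discrete_valuation_subring_of_ring_on:
  fixes V :: "'k::field set"
  assumes "discrete_valuation_ring (ring_on V)"
  shows "discrete_valuation_subring V"
proof -
  let ?R = "ring_on V"
  interpret P: principal_domain ?R
    using assms unfolding discrete_valuation_ring_def by blast
  obtain M where M: "primeideal M ?R" "M \<noteq> {0}"
    and M_unique: "\<And>M'. primeideal M' ?R \<Longrightarrow> M' \<noteq> {0} \<Longrightarrow> M' = M"
    using assms unfolding discrete_valuation_ring_def by auto
  interpret subring_of_field V
    using unital_subring_of_ring_on[OF P.ring_axioms] by (simp add: subring_of_field_def)
  interpret M: primeideal M ?R by fact
  have Units_eq: "Units ?R = units"
  proof -
    have "(\<exists>b\<in>V. a * b = 1) \<longleftrightarrow> a \<noteq> 0 \<and> inverse a \<in> V" for a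
    proof
      assume "\<exists>b\<in>V. a * b = 1"
      then obtain b where "b \<in> V" "a * b = 1" by blast
      moreover from this have "inverse a = b" by (intro inverse_unique)
      ultimately show "a \<noteq> 0 \<and> inverse a \<in> V" by auto
    qed (auto intro!: bexI[of _ "inverse a"])
    then show ?thesis
      unfolding Units_ring_on units_def by simp
  qed
  obtain \<pi> where \<pi>: "\<pi> \<in> V" "M = PIdl\<^bsub>?R\<^esub> \<pi>"
    using P.exists_gen[OF M.is_ideal] by auto
  have "\<pi> \<noteq> 0"
    using M(2) \<pi> zero_mem unfolding cgenideal_def by auto
  have "inverse \<pi> \<notin> V"
  proof
    assume "inverse \<pi> \<in> V"
    then have "x \<in> M" if "x \<in> V" for x
      unfolding \<pi>(2) cgenideal_def using that mult_mem \<open>\<pi> \<noteq> 0\<close>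
      by (auto intro!: exI[of _ "x * inverse \<pi>"])
    then show False
      using M.I_notcarr M.a_subset by auto
  qed
  moreover have "\<exists>k. \<exists>u\<in>units. x = u * \<pi> ^ k" if x: "x \<in> V" "x \<noteq> 0" for x
  proof -
    have irred: "\<exists>u\<in>units. p = u * \<pi>" if "Divisibility.irreducible (mult_of ?R) p" "p \<in> V" "p \<noteq> 0" for p
    proof -
      have ri: "ring_irreducible\<^bsub>?R\<^esub> p"
        using P.ring_irreducibleI' that by simp
      then have "primeideal (PIdl\<^bsub>?R\<^esub> p) ?R"
        using P.maximalideal_prime P.irreducible_imp_maximalideal that(2) by simp
      moreover have "p \<in> PIdl\<^bsub>?R\<^esub> p"
        using P.cgenideal_self that(2) by simp
      ultimately have "PIdl\<^bsub>?R\<^esub> p = M"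
        using M_unique that(3) by blast
      then have "p \<sim>\<^bsub>?R\<^esub> \<pi>"
        using P.associated_iff_same_ideal that(2) \<pi> by simp
      then have "\<exists>c\<in>V. \<pi> = p * c" "\<exists>d\<in>V. p = \<pi> * d"
        unfolding associated_def factor_def by simp_all
      then obtain c d where cd: "c \<in> V" "d \<in> V" "\<pi> = p * c" "p = \<pi> * d"
        by blast
      have "p * (c * d) = p * 1"
        by (metis cd(3,4) mult.assoc mult.right_neutral)
      then have "c * d = 1"
        using mult_left_cancel[OF that(3)] by blast
      then have "d * c \<in> units"
        using units_one by (simp add: mult.commute)
      then have "d \<in> units"
        using units_factor cd by blast
      then show ?thesis
        using cd(4) by (auto simp: mult.commute)
    qed
    have prod: "\<exists>k. \<exists>u\<in>units. foldr (*) fs 1 = u * \<pi> ^ k"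
      if "set fs \<subseteq> V - {0}" "\<forall>p\<in>set fs. Divisibility.irreducible (mult_of ?R) p" for fs
      using that
    proof (induction fs)
      case Nil
      then show ?case using units_one by (auto intro!: exI[of _ 0] bexI[of _ 1])
    next
      case (Cons p fs)
      obtain k u where u: "u \<in> units" "foldr (*) fs 1 = u * \<pi> ^ k"
        using Cons by auto
      obtain v where v: "v \<in> units" "p = v * \<pi>"
        using irred Cons.prems by auto
      have "foldr (*) (p # fs) 1 = (v * u) * \<pi> ^ Suc k"
        using u v by simp
      then show ?case
        using units_mult[OF v(1) u(1)] by blast
    qed
    obtain fs where fs: "set fs \<subseteq> V - {0}" "wfactors (mult_of ?R) fs x"
      using P.mult_of.wfactors_exist[of x] x by auto
    have "foldr (*) fs 1 \<sim>\<^bsub>mult_of ?R\<^esub> x"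
    proof -
      have "(\<otimes>\<^bsub>mult_of ?R\<^esub>) = ((*) :: 'k \<Rightarrow> 'k \<Rightarrow> 'k)"
        by (intro ext) simp
      then show ?thesis
        using fs(2) unfolding wfactors_def by simp
    qed
    then have "\<exists>c\<in>V. x = foldr (*) fs 1 * c" "\<exists>d\<in>V. foldr (*) fs 1 = x * d"
      unfolding associated_def factor_def by auto
    then obtain c d where cd: "c \<in> V" "d \<in> V" "x = foldr (*) fs 1 * c" "foldr (*) fs 1 = x * d"
      by blast
    have "x * (d * c) = x * 1"
      by (metis cd(3,4) mult.assoc mult.right_neutral)
    then have "c * d = 1"
      using mult_left_cancel[OF x(2)] by (metis mult.commute)
    then have "c \<in> units"
      using units_factor[of c d] units_one cd by simp
    obtain k u where u: "u \<in> units" "foldr (*) fs 1 = u * \<pi> ^ k"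
      using prod fs unfolding wfactors_def by blast
    then have "x = (c * u) * \<pi> ^ k"
      using cd(3) by (simp add: mult_ac)
    then show ?thesis
      using units_mult[OF \<open>c \<in> units\<close> u(1)] by blast
  qed
  ultimately show ?thesis
    using \<pi>(1) \<open>\<pi> \<noteq> 0\<close> by (intro_locales, intro discrete_valuation_subring_axioms.intro) blast
qed

abbreviation height_one_localizations :: "'a::idom fract set set" where
  "height_one_localizations \<equiv> localization_at ` height_one_primes"

lemma krull_family_of_krull_domain:
  assumes "krull_domain TYPE('a::idom)"
  shows "krull_family (height_one_localizations :: 'a fract set set)"
    and "\<Inter>(height_one_localizations :: 'a fract set set) = range (\<lambda>a. Fract a 1)"
proof -
  show eq: "\<Inter>(height_one_localizations :: 'a fract set set) = range (\<lambda>a. Fract a 1)"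
    using assms unfolding krull_domain_def by simp
  show "krull_family (height_one_localizations :: 'a fract set set)"
  proof (rule krull_family.intro)
    show "discrete_valuation_subring V" if "V \<in> height_one_localizations" for V :: "'a fract set"
      using that assms discrete_valuation_subring_of_ring_on unfolding krull_domain_def by blast
    fix x :: "'a fract" assume x: "x \<in> \<Inter>height_one_localizations" "x \<noteq> 0"
    then obtain a where a: "x = Fract a 1"
      unfolding eq by auto
    then have "a \<noteq> 0"
      using x(2) by (auto simp: fract_collapse)
    then have "finite {P \<in> height_one_primes. a \<in> P}"
      using assms unfolding krull_domain_def by blast
    moreover have "{V \<in> height_one_localizations. inverse x \<notin> V}
        \<subseteq> localization_at ` {P \<in> height_one_primes. a \<in> P}"
      unfolding a localization_at_def by auto
    ultimately show "finite {V \<in> height_one_localizations. inverse x \<notin> V}"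
      using finite_surj by blast
  qed
qed

section \<open>Termination of factorization\<close>

context krull_family
begin

definition total_ord :: "'k \<Rightarrow> nat" where
  "total_ord x = (\<Sum>V | V \<in> \<V> \<and> inverse x \<notin> V. discrete_valuation_subring.ord V x)"

text \<open>
  Enlarging the index set adds only rings in which \<open>x\<close> is a unit. This allows sums for different
  elements to be taken over the same set.
\<close>

lemma total_ord_eq:
  assumes "x \<in> R" "x \<noteq> 0" "finite \<S>" "\<S> \<subseteq> \<V>" "{V \<in> \<V>. inverse x \<notin> V} \<subseteq> \<S>"
  shows "total_ord x = (\<Sum>V\<in>\<S>. discrete_valuation_subring.ord V x)"
  unfolding total_ord_def
proof (rule sum.mono_neutral_left[OF assms(3,5)], rule ballI)
  fix V assume V: "V \<in> \<S> - {V \<in> \<V>. inverse x \<notin> V}"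
  then have "V \<in> \<V>" "inverse x \<in> V"
    using assms(4) by auto
  interpret V: discrete_valuation_subring V
    by (rule dvr) fact
  have "x \<in> V"
    using assms(1) \<open>V \<in> \<V>\<close> by blast
  then show "V.ord x = 0"
    using V.ord_eq_0_iff[of x] assms(2) \<open>inverse x \<in> V\<close> unfolding V.units_def by simp
qed

lemma total_ord_mult:
  assumes x: "x \<in> R" "x \<noteq> 0" and y: "y \<in> R" "y \<noteq> 0"
  shows "total_ord (x * y) = total_ord x + total_ord y"
proof -
  define \<S> where "\<S> = {V \<in> \<V>. inverse x \<notin> V} \<union> {V \<in> \<V>. inverse y \<notin> V}"
  have \<S>: "finite \<S>" "\<S> \<subseteq> \<V>"
    unfolding \<S>_def using finite_support x y by auto
  have "inverse (x * y) \<in> V" if "V \<in> \<V>" "inverse x \<in> V" "inverse y \<in> V" for V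
  proof -
    interpret V: subring_of_field V
      by (rule subring_of_field_member[OF that(1)])
    show ?thesis
      using V.mult_mem[OF that(2,3)] by simp
  qed
  then have "{V \<in> \<V>. inverse (x * y) \<notin> V} \<subseteq> \<S>"
    unfolding \<S>_def by blast
  then have "total_ord (x * y) = (\<Sum>V\<in>\<S>. discrete_valuation_subring.ord V (x * y))"
    using x y \<S> mult_mem[OF x(1) y(1)] by (intro total_ord_eq) auto
  also have "\<dots> = (\<Sum>V\<in>\<S>. discrete_valuation_subring.ord V x + discrete_valuation_subring.ord V y)"
  proof (rule sum.cong[OF refl])
    fix V assume "V \<in> \<S>"
    then have V: "V \<in> \<V>" using \<S>(2) by blast
    then have "x \<in> V" "y \<in> V" using x y by blast+
    then show "discrete_valuation_subring.ord V (x * y)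
        = discrete_valuation_subring.ord V x + discrete_valuation_subring.ord V y"
      using discrete_valuation_subring.ord_mult[OF dvr[OF V]] x y by blast
  qed
  also have "\<dots> = total_ord x + total_ord y"
    using total_ord_eq[OF x \<S>] total_ord_eq[OF y \<S>] unfolding sum.distrib \<S>_def by simp
  finally show ?thesis .
qed

lemma total_ord_pos:
  assumes x: "x \<in> R" "x \<noteq> 0" and "x \<notin> units"
  shows "0 < total_ord x"
proof -
  obtain V where V: "V \<in> \<V>" "inverse x \<notin> V"
    using assms unfolding units_def by auto
  interpret V: discrete_valuation_subring V
    by (rule dvr[OF V(1)])
  have "0 < V.ord x"
    using V.ord_eq_0_iff[of x] x V unfolding V.units_def by auto
  also have "\<dots> \<le> total_ord x"
    unfolding total_ord_def using V finite_support[OF x]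
    by (intro member_le_sum[of V _ "\<lambda>V. discrete_valuation_subring.ord V x"]) auto
  finally show ?thesis .
qed

end

section \<open>Passage to the fraction field\<close>

definition fract_series :: "'a::idom fps \<Rightarrow> 'a fract fps" where
  "fract_series f = Abs_fps (\<lambda>n. to_fract (f $ n))"

lemma fract_series_nth [simp]: "fract_series f $ n = to_fract (f $ n)"
  by (simp add: fract_series_def)

lemma to_fract_sum: "to_fract (sum f A) = (\<Sum>i\<in>A. to_fract (f i))"
  by (induction A rule: infinite_finite_induct) auto

lemma fract_series_mult: "fract_series (f * g) = fract_series f * fract_series g"
  by (simp add: fps_eq_iff fps_mult_nth to_fract_sum)

lemma fract_series_diff: "fract_series (f - g) = fract_series f - fract_series g"
  by (simp add: fps_eq_iff)

lemma fract_series_eq_iff: "fract_series f = fract_series g \<longleftrightarrow> f = g"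
  by (simp add: fps_eq_iff)

lemma X_pow_dvd_fract_series_iff: "fps_X ^ n dvd fract_series f \<longleftrightarrow> fps_X ^ n dvd f"
  unfolding X_pow_dvd_iff by simp

lemma ex_fract_series: "x \<in> power_series_over (range to_fract) \<Longrightarrow> \<exists>f. x = fract_series f"
proof -
  assume "x \<in> power_series_over (range to_fract)"
  then have "\<forall>n. \<exists>a. x $ n = to_fract a"
    unfolding power_series_over_def by auto
  then obtain a where "\<And>n. x $ n = to_fract (a n)"
    by metis
  then have "x = fract_series (Abs_fps a)"
    by (simp add: fps_eq_iff)
  then show ?thesis by blast
qed

lemma fract_series_mem: "fract_series f \<in> power_series_over (range to_fract)"
  by (simp add: power_series_over_def)

text \<open>
  The domain embeds in its fraction field as the intersection of the family. So results on series over
  the intersection are results on \<open>'a fps\<close>.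
\<close>

locale krull_subring_family =
  krull_family \<V> for \<V> :: "'a::idom fract set set" +
  assumes Inter_eq: "\<Inter>\<V> = range to_fract"
begin

lemma units_iff: "to_fract a \<in> units \<longleftrightarrow> a dvd 1"
proof
  assume "to_fract a \<in> units"
  then obtain b where b: "inverse (to_fract a) = to_fract b" "to_fract a \<noteq> 0"
    unfolding units_def unfolding Inter_eq by auto
  then have "to_fract (a * b) = to_fract 1"
    by (metis right_inverse to_fract_1 to_fract_mult)
  then have "1 = a * b"
    by (simp only: to_fract_eq_iff)
  then show "a dvd 1" ..
next
  assume "a dvd 1"
  then obtain b where b: "1 = a * b" ..
  then have "to_fract a * to_fract b = 1"
    by (metis to_fract_1 to_fract_mult)
  then have "to_fract a \<noteq> 0" "inverse (to_fract a) = to_fract b"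
    using inverse_unique by auto
  then show "to_fract a \<in> units"
    unfolding units_def unfolding Inter_eq by auto
qed

lemma dvd_fps_closed:
  fixes f p :: "'a fps"
  assumes "p $ 0 \<noteq> 0" "\<And>n. \<exists>r. fps_X ^ n dvd f - p * r"
  shows "p dvd f"
proof -
  have "\<exists>r\<in>power_series_over R. fps_X ^ n dvd fract_series f - fract_series p * r" for n
  proof -
    obtain r where "fps_X ^ n dvd f - p * r"
      using assms(2) by blast
    then have "fps_X ^ n dvd fract_series f - fract_series p * fract_series r"
      by (simp flip: fract_series_mult fract_series_diff add: X_pow_dvd_fract_series_iff)
    then show ?thesis
      using fract_series_mem unfolding Inter_eq by blast
  qed
  then obtain r where r: "r \<in> power_series_over R" "fract_series f = fract_series p * r"
    using dvd_closed[of "fract_series p" "fract_series f"] assms(1) by auto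
  then obtain r' where "r = fract_series r'"
    using ex_fract_series unfolding Inter_eq by blast
  then have "f = p * r'"
    using r(2) by (simp flip: fract_series_mult add: fract_series_eq_iff)
  then show ?thesis ..
qed

lemma fps_dvd_1_iff: "(f :: 'a fps) dvd 1 \<longleftrightarrow> f $ 0 dvd 1"
proof
  assume "f dvd 1"
  then obtain g where "1 = f * g" ..
  then have "1 = f $ 0 * g $ 0"
    by (metis fps_mult_nth_0 fps_one_nth)
  then show "f $ 0 dvd 1" ..
next
  assume unit: "f $ 0 dvd 1"
  have "inverse (fract_series f) \<in> power_series_over R"
    using inverse_mem_PS[of "fract_series f"] fract_series_mem[of f] unit
    by (simp add: units_iff flip: Inter_eq)
  then obtain g where g: "inverse (fract_series f) = fract_series g"
    using ex_fract_series unfolding Inter_eq by blast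
  have "fract_series f $ 0 \<noteq> 0"
    using unit by auto
  then have "fract_series f * fract_series g = 1"
    using inverse_mult_eq_1' g by metis
  also have "1 = fract_series 1"
    by (simp add: fps_eq_iff)
  finally have "1 = f * g"
    by (simp flip: fract_series_mult add: fract_series_eq_iff)
  then show "f dvd 1" ..
qed

lemma fps_reducibility_closed:
  fixes f :: "'a fps"
  assumes "f $ 0 \<noteq> 0"
    and red: "\<And>n. \<exists>p q. \<not> p $ 0 dvd 1 \<and> \<not> q $ 0 dvd 1 \<and> fps_X ^ n dvd p * q - f"
  shows "\<exists>p q. \<not> p $ 0 dvd 1 \<and> \<not> q $ 0 dvd 1 \<and> f = p * q"
proof -
  have "\<exists>p\<in>power_series_over R. \<exists>q\<in>power_series_over R.
      p $ 0 \<notin> units \<and> q $ 0 \<notin> units \<and> fract_series f = p * q"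
  proof (rule reducibility_closed)
    show "fract_series f \<in> power_series_over R" "fract_series f $ 0 \<noteq> 0"
      using fract_series_mem[of f] assms(1) unfolding Inter_eq by auto
    fix n
    obtain p q where pq: "\<not> p $ 0 dvd 1" "\<not> q $ 0 dvd 1" "fps_X ^ n dvd p * q - f"
      using red by blast
    have "fps_X ^ n dvd fract_series p * fract_series q - fract_series f"
      using pq(3) by (simp flip: fract_series_mult fract_series_diff add: X_pow_dvd_fract_series_iff)
    moreover have "fract_series p $ 0 \<notin> units" "fract_series q $ 0 \<notin> units"
      using pq by (simp_all add: units_iff)
    ultimately show "\<exists>p\<in>power_series_over R. \<exists>q\<in>power_series_over R.
        p $ 0 \<notin> units \<and> q $ 0 \<notin> units \<and> fps_X ^ n dvd p * q - fract_series f"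
      using fract_series_mem unfolding Inter_eq by blast
  qed
  then obtain x y where xy: "x \<in> power_series_over R" "y \<in> power_series_over R"
    "x $ 0 \<notin> units" "y $ 0 \<notin> units" "fract_series f = x * y"
    by blast
  obtain p q where pq: "x = fract_series p" "y = fract_series q"
    using ex_fract_series xy(1,2) unfolding Inter_eq by blast
  have "f = p * q"
    using xy(5) unfolding pq by (simp flip: fract_series_mult add: fract_series_eq_iff)
  moreover have "\<not> p $ 0 dvd 1" "\<not> q $ 0 dvd 1"
    using xy(3,4) unfolding pq by (simp_all add: units_iff)
  ultimately show ?thesis by blast
qed

definition fps_size :: "'a fps \<Rightarrow> nat" where
  "fps_size f = subdegree f + total_ord (to_fract (f $ subdegree f))"

lemma fps_size_mult_less:
  assumes "x \<noteq> 0" "y \<noteq> 0" "\<not> y dvd 1"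
  shows "fps_size x < fps_size (x * y)"
proof -
  define a b where "a = x $ subdegree x" and "b = y $ subdegree y"
  have nz: "a \<noteq> 0" "b \<noteq> 0"
    unfolding a_def b_def using assms by auto
  have mem: "to_fract a \<in> R" "to_fract b \<in> R"
    unfolding Inter_eq by auto
  have "fps_size (x * y) = fps_size x + fps_size y"
    unfolding fps_size_def using assms total_ord_mult[OF mem(1) _ mem(2)] nz
    by (simp add: a_def b_def)
  moreover have "0 < fps_size y"
  proof (cases "subdegree y = 0")
    case True
    then have "\<not> b dvd 1"
      using assms(3) unfolding b_def fps_dvd_1_iff by simp
    then have "to_fract b \<notin> units"
      by (simp add: units_iff)
    then show ?thesis
      using total_ord_pos[OF mem(2)] nz unfolding fps_size_def b_def by simp
  qed (simp add: fps_size_def)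
  ultimately show ?thesis by simp
qed

end

section \<open>Irreducible power series are prime\<close>

definition map_series :: "('a \<Rightarrow> 'a) \<Rightarrow> 'a::comm_ring_1 fps \<Rightarrow> 'a fps" where
  "map_series \<rho> f = Abs_fps (\<lambda>n. \<rho> (f $ n))"

lemma map_series_nth [simp]: "map_series \<rho> f $ n = \<rho> (f $ n)"
  by (simp add: map_series_def)

context
  fixes S :: "'a::comm_ring_1 set" and \<rho> :: "'a \<Rightarrow> 'a"
  assumes \<rho>: "retraction_onto S \<rho>"
begin

lemma retraction_zero: "\<rho> 0 = 0"
  using retraction_onto_hom(1)[OF \<rho>, of 0 0] by simp

lemma retraction_sum: "\<rho> (sum f A) = (\<Sum>i\<in>A. \<rho> (f i))"
  by (induction A rule: infinite_finite_induct) (simp_all add: retraction_zero retraction_onto_hom(1)[OF \<rho>])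

lemma map_series_mult: "map_series \<rho> (f * g) = map_series \<rho> f * map_series \<rho> g"
  by (simp add: fps_eq_iff fps_mult_nth retraction_sum retraction_onto_hom(2)[OF \<rho>])

lemma map_series_one: "map_series \<rho> 1 = 1"
  by (simp add: fps_eq_iff retraction_zero retraction_onto_hom(3)[OF \<rho>])

lemma map_series_mem: "map_series \<rho> f \<in> power_series_over S"
  by (simp add: power_series_over_def retraction_onto_hom(4)[OF \<rho>])

lemma map_series_id: "f \<in> power_series_over S \<Longrightarrow> map_series \<rho> f = f"
  by (simp add: power_series_over_def fps_eq_iff retraction_onto_hom(5)[OF \<rho>])

lemma map_series_approx:
  assumes "(\<lambda>i. f $ i) ` {..<n} \<subseteq> S"
  shows "fps_X ^ n dvd map_series \<rho> f - f"
  unfolding X_pow_dvd_iff using assms by (auto simp: retraction_onto_hom(5)[OF \<rho>])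

text \<open>The retraction fixes \<open>f\<close>, so it maps an inverse of \<open>f\<close> to an inverse over \<open>S\<close>.\<close>

lemma unit_of_retract:
  assumes "f \<in> power_series_over S" "f dvd 1"
  shows "\<exists>g\<in>power_series_over S. f * g = 1"
proof -
  obtain d where "1 = f * d"
    using assms(2) ..
  then have "f * map_series \<rho> d = 1"
    using map_series_mult[of f d] map_series_id[OF assms(1)] map_series_one by metis
  then show ?thesis
    using map_series_mem by blast
qed

end

context krull_subring_family
begin

text \<open>
  For \<open>n\<close> beyond the precision \<open>n\<^sub>0\<close> from which on factorizations of approximations to \<open>p\<close> are trivial, the
  image of \<open>p\<close> under a retraction is irreducible. Triviality in \<open>R[[X]]\<close> and in \<open>S[[X]]\<close> agree because of
  \<open>unit_of_retract\<close>.
\<close>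

lemma irreducible_imp_prime_elem:
  fixes p :: "'a fps"
  assumes retracts: "\<And>E :: 'a set. finite E \<Longrightarrow>
      \<exists>S \<rho>. subring S whole_ring \<and> retraction_onto S \<rho> \<and> E \<subseteq> S \<and>
        factorial_domain (ring_on (power_series_over S))"
    and p: "Factorial_Ring.irreducible p"
  shows "prime_elem p"
proof (cases "p $ 0 = 0")
  case True
  then have "fps_X ^ 1 dvd p"
    unfolding X_pow_dvd_iff by simp
  then obtain q where q: "p = fps_X * q"
    by auto
  have "\<not> fps_X dvd (1 :: 'a fps)"
    unfolding fps_dvd_1_iff by simp
  then have "q dvd 1"
    using p q by (metis Factorial_Ring.irreducibleD)
  then have p_dvd: "p dvd x" if "x $ 0 = 0" for x
  proof -
    have "fps_X ^ 1 dvd x"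
      unfolding X_pow_dvd_iff using that by simp
    then obtain y where y: "x = fps_X * y"
      by auto
    obtain r where r: "1 = q * r"
      using \<open>q dvd 1\<close> ..
    have "p * (r * y) = fps_X * ((q * r) * y)"
      unfolding q by (simp only: mult_ac)
    then have "x = p * (r * y)"
      unfolding y r[symmetric] mult_1_left by (rule sym)
    then show ?thesis ..
  qed
  show ?thesis
  proof (rule prime_elemI)
    show "p \<noteq> 0" "\<not> p dvd 1"
      using p by (auto simp: Factorial_Ring.irreducible_def)
    fix a b assume "p dvd a * b"
    then obtain c where "a * b = p * c" ..
    then have "(a * b) $ 0 = 0"
      using True by simp
    then show "p dvd a \<or> p dvd b"
      using p_dvd by auto
  qed
next
  case False
  have nonunit: "\<not> p dvd 1"
    using p by (auto simp: Factorial_Ring.irreducible_def)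
  have "\<not> (\<exists>a b. \<not> a $ 0 dvd 1 \<and> \<not> b $ 0 dvd 1 \<and> p = a * b)"
    using Factorial_Ring.irreducibleD[OF p] by (auto simp: fps_dvd_1_iff)
  then obtain n\<^sub>0 where n0: "\<And>a b. fps_X ^ n\<^sub>0 dvd a * b - p \<Longrightarrow> a $ 0 dvd 1 \<or> b $ 0 dvd 1"
    using fps_reducibility_closed[OF False] by metis
  have dichotomy: "(\<exists>r. fps_X ^ n dvd g - p * r) \<or> (\<exists>r. fps_X ^ n dvd h - p * r)"
    if n: "n\<^sub>0 \<le> n" and k: "g * h = p * k" for n g h k
  proof -
    define E where "E = (\<lambda>i. p $ i) ` {..<Suc n} \<union> (\<lambda>i. g $ i) ` {..<Suc n} \<union> (\<lambda>i. h $ i) ` {..<Suc n}"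
    have "finite E"
      unfolding E_def by simp
    from retracts[OF this] obtain S \<rho> where
      S: "retraction_onto S \<rho>" "E \<subseteq> S" "factorial_domain (ring_on (power_series_over S))"
      by blast
    let ?\<rho> = "map_series \<rho>"
    have approx: "fps_X ^ Suc n dvd ?\<rho> p - p" "fps_X ^ Suc n dvd ?\<rho> g - g" "fps_X ^ Suc n dvd ?\<rho> h - h"
      using S(2) unfolding E_def by (intro map_series_approx[OF S(1)], blast)+
    have p0: "?\<rho> p $ 0 = p $ 0"
      using approx(1) unfolding X_pow_dvd_iff by auto
    have "(\<exists>c\<in>power_series_over S. ?\<rho> g = ?\<rho> p * c) \<or> (\<exists>c\<in>power_series_over S. ?\<rho> h = ?\<rho> p * c)"
    proof (rule irreducible_dvd_mult_in_factorial_domain[OF S(3)])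
      show "?\<rho> p \<noteq> 0"
        using p0 False by (metis fps_zero_nth)
      show "\<not> (\<exists>b\<in>power_series_over S. ?\<rho> p * b = 1)"
      proof
        assume "\<exists>b\<in>power_series_over S. ?\<rho> p * b = 1"
        then have "?\<rho> p dvd 1"
          by (metis dvd_triv_left)
        then show False
          using nonunit p0 unfolding fps_dvd_1_iff by (simp only:)
      qed
      show "?\<rho> p * ?\<rho> k = ?\<rho> g * ?\<rho> h"
        using k by (simp flip: map_series_mult[OF S(1)])
      fix a b assume ab: "a \<in> power_series_over S" "b \<in> power_series_over S" "?\<rho> p = a * b"
      have "fps_X ^ n\<^sub>0 dvd a * b - p"
        using X_pow_dvd_mono[OF approx(1), of n\<^sub>0] n ab(3) by simp
      then have "a dvd 1 \<or> b dvd 1"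
        using n0 by (simp add: fps_dvd_1_iff)
      then show "(\<exists>c\<in>power_series_over S. a * c = 1) \<or> (\<exists>c\<in>power_series_over S. b * c = 1)"
        using unit_of_retract[OF S(1)] ab by blast
    qed (simp_all add: map_series_mem[OF S(1)])
    moreover have "fps_X ^ n dvd x - p * c" if "fps_X ^ Suc n dvd ?\<rho> x - x" "?\<rho> x = ?\<rho> p * c" for x c
    proof -
      have "fps_X ^ Suc n dvd (?\<rho> p - p) * c - (?\<rho> x - x)"
        by (rule dvd_diff[OF dvd_mult2[OF approx(1)] that(1)])
      also have "(?\<rho> p - p) * c - (?\<rho> x - x) = x - p * c"
        using that(2) by (simp add: algebra_simps)
      finally show ?thesis
        using X_pow_dvd_mono[of "Suc n" _ n] by simp
    qed
    ultimately show ?thesis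
      using approx(2,3) by blast
  qed
  show ?thesis
  proof (rule prime_elemI)
    show "p \<noteq> 0" "\<not> p dvd 1"
      using p nonunit by (auto simp: Factorial_Ring.irreducible_def)
    fix g h assume "p dvd g * h"
    then obtain k where k: "g * h = p * k" ..
    show "p dvd g \<or> p dvd h"
    proof (rule ccontr)
      assume "\<not> (p dvd g \<or> p dvd h)"
      then obtain n m where nm: "\<not> (\<exists>r. fps_X ^ n dvd g - p * r)" "\<not> (\<exists>r. fps_X ^ m dvd h - p * r)"
        using dvd_fps_closed[OF False] by blast
      define N where "N = max n\<^sub>0 (max n m)"
      have N: "n\<^sub>0 \<le> N" "n \<le> N" "m \<le> N"
        unfolding N_def by auto
      show False
        using dichotomy[OF N(1) k] nm X_pow_dvd_mono[OF _ N(2)] X_pow_dvd_mono[OF _ N(3)] by blast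
    qed
  qed
qed

end

theorem theorem3:
  assumes "krull_domain TYPE('a::idom)"
    and "\<And>E :: 'a set. finite E \<Longrightarrow>
      \<exists>S \<rho>. subring S whole_ring \<and> retraction_onto S \<rho> \<and> E \<subseteq> S \<and>
        factorial_domain (ring_on (power_series_over S))"
  shows "factorial_domain (whole_ring :: 'a fps ring)"
proof -
  let ?\<V> = "height_one_localizations :: 'a fract set set"
  interpret krull_family ?\<V>
    by (rule krull_family_of_krull_domain(1)[OF assms(1)])
  interpret krull_subring_family ?\<V>
    using krull_family_of_krull_domain(2)[OF assms(1)] by unfold_locales (simp add: to_fract_def)
  show ?thesis
    using fps_size_mult_less irreducible_imp_prime_elem[OF assms(2)]
    by (rule factorial_domain_whole_ringI)
qed

end
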